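(* Let $K\subset\mathbb{R}^2$ be a compact convex set of area $F$ with boundary of class $\mathcal{C}^2$, having the origin as an interior point. Let $f$ be a $\pi$-periodic continuous function on $\mathbb{R}$, and $H$ a $\mathcal{C}^2$ function on $[-\pi,\pi]$ satisfying $H''(x)=f(x)\sin(x)$ for $x\in[-\pi,\pi]$ and $H(0)=H'(0)=0$. Then $$\int_{G_i\cap K\neq\emptyset}f(\varphi_2-\varphi_1)\,dG_1\,dG_2=(H(\pi)-H(-\pi))F+\int_{P\notin K}(H(\omega)-H(-\omega))\,dP.$$ If moreover $f(-x)=f(x)$ for all $x$, and $H$ is a $\mathcal{C}^2$ function on $[0,\pi]$ with $H''(x)=f(x)\sin(x)$ for $x\in[0,\pi]$ and $H(0)=H'(0)=0$, one has $$\int_{G_i\cap K\neq\emptyset}f(\varphi_2-\varphi_1)\,dG_1\,dG_2=2H(\pi)F+2\int_{P\notin K}H(\omega)\,dP.$$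
   Context: For $P\notin K$, $\omega=\omega(P)\in(0,\pi)$ is the visual angle of $K$ from $P$, i.e. the angle between the two tangents from $P$ to the boundary of $K$ (the angle at $P$ of the sector with vertex $P$ containing $K$), and $dP$ is the area element of the plane. A line $G\subset\mathbb{R}^2$ not passing through the origin is given coordinates $(p,\varphi)$, $p>0$, $0\le\varphi<2\pi$, which are the polar coordinates of the point of $G$ at minimum distance from the origin (lines through the origin form a null set and are disregarded). $dG=dp\,d\varphi$, and ordered pairs of lines $(G_1,G_2)$, with coordinates $(p_i,\varphi_i)$, carry the measure $dG_1\,dG_2=dp_1\,d\varphi_1\,dp_2\,d\varphi_2$. The integral over $G_i\cap K\neq\emptyset$ is over all ordered pairs $(G_1,G_2)$ such that both $G_1$ and $G_2$ meet $K$. *)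

theory Defs
  imports "HOL-Analysis.Analysis"
begin

definition C2_on ::
  "real set \<Rightarrow> (real \<Rightarrow> 'a::real_normed_vector) \<Rightarrow> (real \<Rightarrow> 'a) \<Rightarrow> (real \<Rightarrow> 'a) \<Rightarrow> bool"
  where "C2_on S g g' g'' \<longleftrightarrow>
    (\<forall>x\<in>S. (g has_vector_derivative g' x) (at x within S)) \<and>
    (\<forall>x\<in>S. (g' has_vector_derivative g'' x) (at x within S)) \<and>
    continuous_on S g''"

text \<open>The boundary is a regular simple closed curve of class $C^2$, parametrized by a
  periodic map on the whole line so that no condition at an end point is needed.\<close>

definition C2_boundary :: "(real^2) set \<Rightarrow> bool"
  where "C2_boundary K \<longleftrightarrow>
    (\<exists>\<gamma> \<gamma>' \<gamma>'' L. 0 < L \<and> C2_on UNIV \<gamma> \<gamma>' \<gamma>'' \<and> (\<forall>t. \<gamma>' t \<noteq> 0) \<and>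
      (\<forall>t. \<gamma> (t + L) = \<gamma> t) \<and> inj_on \<gamma> {0..<L} \<and> range \<gamma> = frontier K)"

definition unit_vec :: "real \<Rightarrow> real^2"
  where "unit_vec \<phi> = vector [cos \<phi>, sin \<phi>]"

definition coord_line :: "real \<Rightarrow> real \<Rightarrow> (real^2) set"
  where "coord_line p \<phi> = {x. x \<bullet> unit_vec \<phi> = p}"

lemma norm_unit_vec: "norm (unit_vec \<phi>) = 1"
  by (simp add: unit_vec_def norm_vec_def L2_set_def sum_2)

lemma inner_unit_vec_self: "unit_vec \<phi> \<bullet> unit_vec \<phi> = 1"
  by (simp add: dot_square_norm norm_unit_vec)

text \<open>The point of the line nearest to the origin has polar coordinates \<open>(p, \<phi>)\<close>.\<close>

lemma closest_point_coord_line: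
  assumes "0 < p"
  shows "closest_point (coord_line p \<phi>) 0 = p *\<^sub>R unit_vec \<phi>"
proof -
  let ?q = "p *\<^sub>R unit_vec \<phi>"
  have eq: "coord_line p \<phi> = {x. unit_vec \<phi> \<bullet> x = p}"
    by (simp add: coord_line_def inner_commute)
  have "?q = closest_point (coord_line p \<phi>) 0"
  proof (rule closest_point_unique)
    show "convex (coord_line p \<phi>)" "closed (coord_line p \<phi>)"
      by (simp_all only: eq convex_hyperplane closed_hyperplane)
    show "?q \<in> coord_line p \<phi>"
      by (simp add: coord_line_def inner_unit_vec_self)
    show "\<forall>z\<in>coord_line p \<phi>. dist 0 ?q \<le> dist 0 z"
    proof
      fix z assume "z \<in> coord_line p \<phi>"
      then show "dist 0 ?q \<le> dist 0 z"
        using assms Cauchy_Schwarz_ineq2[of z "unit_vec \<phi>"]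
        by (simp add: coord_line_def norm_unit_vec)
    qed
  qed
  then show ?thesis by simp
qed

definition line_pairs_meeting :: "(real^2) set \<Rightarrow> ((real \<times> real) \<times> (real \<times> real)) set"
  where "line_pairs_meeting K =
    {((p1, \<phi>1), (p2, \<phi>2)).
       0 < p1 \<and> 0 \<le> \<phi>1 \<and> \<phi>1 < 2 * pi \<and> coord_line p1 \<phi>1 \<inter> K \<noteq> {} \<and>
       0 < p2 \<and> 0 \<le> \<phi>2 \<and> \<phi>2 < 2 * pi \<and> coord_line p2 \<phi>2 \<inter> K \<noteq> {}}"

text \<open>The curve \<open>c\<close> is differentiated on both sides of the point \<open>x\<close>, so that at a
  regular point of a curve \<open>S\<close> the tangent vectors form the tangent line.\<close>

definition tangent_vector :: "(real^2) set \<Rightarrow> real^2 \<Rightarrow> real^2 \<Rightarrow> bool"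
  where "tangent_vector S x v \<longleftrightarrow>
    (\<exists>c. c 0 = x \<and> range c \<subseteq> S \<and> (c has_vector_derivative v) (at 0))"

text \<open>The half-line from \<open>P\<close> in direction \<open>\<alpha>\<close> touches the boundary of \<open>K\<close> tangentially.\<close>

definition tangent_from :: "(real^2) set \<Rightarrow> real^2 \<Rightarrow> real \<Rightarrow> bool"
  where "tangent_from K P \<alpha> \<longleftrightarrow>
    (\<exists>r>0. P + r *\<^sub>R unit_vec \<alpha> \<in> frontier K \<and>
           tangent_vector (frontier K) (P + r *\<^sub>R unit_vec \<alpha>) (unit_vec \<alpha>))"

definition sector :: "real^2 \<Rightarrow> real \<Rightarrow> real \<Rightarrow> (real^2) set"
  where "sector P \<alpha> \<omega> = {P + r *\<^sub>R unit_vec \<theta> | r \<theta>. 0 \<le> r \<and> \<alpha> \<le> \<theta> \<and> \<theta> \<le> \<alpha> + \<omega>}"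

text \<open>The angle between the two tangents from \<open>P\<close>, measured in the sector that contains
  \<open>K\<close>. It is meaningful only for \<open>P\<close> outside \<open>K\<close>.\<close>

definition visual_angle :: "(real^2) set \<Rightarrow> real^2 \<Rightarrow> real"
  where "visual_angle K P =
    (THE \<omega>. 0 < \<omega> \<and> \<omega> < pi \<and>
      (\<exists>\<alpha>. K \<subseteq> sector P \<alpha> \<omega> \<and> tangent_from K P \<alpha> \<and> tangent_from K P (\<alpha> + \<omega>)))"

end

theory Submission
  imports Defs
begin

text \<open>
  Two lines with normal angles \<open>\<phi>1\<close> and \<open>\<phi>2\<close>, not parallel, are determined by their point of
  intersection \<open>P\<close> and these angles, since the line with normal angle \<open>\<phi>\<close> through \<open>P\<close> is at signed
  distance \<open>P \<bullet> unit_vec \<phi>\<close> from the origin.  For fixed angles the map from \<open>P\<close> to the two distances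
  is linear with determinant \<open>sin (\<phi>2 - \<phi>1)\<close>, so that \<open>dG1 dG2 = |sin (\<phi>2 - \<phi>1)| dP d\<phi>1 d\<phi>2\<close>
  (\<open>lborel_line_pairs\<close>).  With \<open>g x = f x * |sin x|\<close>, the left-hand side of the theorem
  is therefore the integral over all \<open>P\<close> of the double integral of \<open>g (\<phi>2 - \<phi>1)\<close> over the
  normal angles of the lines through \<open>P\<close> that meet \<open>K\<close>.

  The kernel \<open>g\<close> is \<open>pi\<close>-periodic, so it takes the same values whichever of the two opposite normals
  of a line is used, and the normals may be read modulo \<open>pi\<close> (\<open>integral_normals_of_pencil\<close>).  Modulo
  \<open>pi\<close> they form everything if \<open>P\<close> lies in \<open>K\<close>, and an arc whose length is the visual angle if it does
  not (\<open>pencil_visual_angle\<close>).  If \<open>J\<close> has second derivative \<open>g\<close> and \<open>J 0 = 0\<close>, the double integral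
  of \<open>g (y - x)\<close> over an interval of length \<open>\<omega>\<close> is \<open>J \<omega> + J (- \<omega>)\<close>
  (\<open>double_integral_difference_kernel\<close>).  This gives the formula with \<open>J \<omega> + J (- \<omega>)\<close> in place of the
  expressions in \<open>H\<close> (\<open>line_pairs_integral_potential\<close>).

  Finally, \<open>|sin x|\<close> is \<open>sin x\<close> on \<open>[0, pi]\<close> and \<open>- sin x\<close> on \<open>[- pi, 0]\<close>.  If also \<open>J' 0 = 0\<close>, then
  \<open>J\<close> agrees with \<open>H\<close> on the former interval and with \<open>- H\<close> on the latter, and it is even when \<open>f\<close> is.
\<close>

section \<open>Unit vectors in the plane\<close>

lemma inner_unit_vec: "x \<bullet> unit_vec \<phi> = x $ 1 * cos \<phi> + x $ 2 * sin \<phi>"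
  by (simp add: unit_vec_def inner_vec_def sum_2)

lemma unit_vec_add_pi: "unit_vec (\<phi> + pi) = - unit_vec \<phi>"
  by (simp add: unit_vec_def vec_eq_iff forall_2 vector_2)

lemma inner_unit_vec_unit_vec: "unit_vec a \<bullet> unit_vec b = cos (a - b)"
  by (simp add: inner_unit_vec cos_diff) (simp add: unit_vec_def vector_2)

lemma unit_vec_decomp: "v = (v \<bullet> unit_vec a) *\<^sub>R unit_vec a + (v \<bullet> unit_vec (a + pi / 2)) *\<^sub>R unit_vec (a + pi / 2)"
proof -
  have 1: "cos (a + pi/2) = - sin a" "sin (a + pi/2) = cos a"
    by (simp_all add: cos_add sin_add)
  have sc: "x * (cos a * cos a) + x * (sin a * sin a) = x" for x
    using sin_cos_squared_add[of a] by (simp add: power2_eq_square add.commute flip: distrib_left)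
  show ?thesis
    using sc[of "v $ 1"] sc[of "v $ 2"]
    by (simp add: vec_eq_iff forall_2 unit_vec_def vector_2 inner_vec_def sum_2 1
      right_diff_distrib distrib_left mult_ac)
qed

lemma polar_form:
  obtains \<theta> where "v = norm v *\<^sub>R unit_vec \<theta>"
proof (cases "v = 0")
  case True
  then show thesis by (intro that) simp
next
  case False
  define \<rho> where "\<rho> = norm v"
  have \<rho>: "\<rho> > 0" using False by (simp add: \<rho>_def)
  have "(v $ 1)\<^sup>2 + (v $ 2)\<^sup>2 = \<rho>\<^sup>2"
    by (simp add: \<rho>_def norm_vec_def L2_set_def sum_2)
  with \<rho> have "(v $ 1 / \<rho>)\<^sup>2 + (v $ 2 / \<rho>)\<^sup>2 = 1"
    by (simp add: power_divide add_divide_distrib[symmetric] del: sum_power2_eq_zero_iff)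
  then obtain \<theta> where "v $ 1 / \<rho> = cos \<theta>" "v $ 2 / \<rho> = sin \<theta>"
    using sincos_total_2pi by metis
  then have "v = \<rho> *\<^sub>R unit_vec \<theta>"
    using \<rho> by (auto simp: vec_eq_iff forall_2 unit_vec_def vector_2 field_simps)
  then show thesis unfolding \<rho>_def by (rule that)
qed

lemma continuous_unit_vec: "continuous_on S unit_vec"
proof -
  have eq: "unit_vec = (\<lambda>\<phi>. cos \<phi> *\<^sub>R axis 1 1 + sin \<phi> *\<^sub>R axis 2 1)"
    by (simp add: fun_eq_iff unit_vec_def vec_eq_iff forall_2 vector_2 axis_def)
  show ?thesis unfolding eq by (intro continuous_intros)
qed

lemma borel_measurable_inner_unit_vec [measurable (raw)]:
  assumes [measurable]: "g \<in> borel_measurable M" "h \<in> borel_measurable M"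
  shows "(\<lambda>x. g x \<bullet> unit_vec (h x)) \<in> borel_measurable M"
proof -
  have [measurable]: "unit_vec \<in> borel_measurable borel"
    by (rule borel_measurable_continuous_onI[OF continuous_unit_vec])
  show ?thesis by measurable
qed

section \<open>The measure of pairs of lines\<close>

text \<open>The change of variables from the point of intersection to the two distances, for fixed normal
angles: the linear map has determinant \<open>sin (\<phi>2 - \<phi>1)\<close>, and it suffices to compare both
measures on boxes.\<close>

lemma lborel_two_normals:
  fixes \<phi>1 \<phi>2 :: real
  assumes nz: "sin (\<phi>2 - \<phi>1) \<noteq> 0"
  shows "(lborel :: (real \<times> real) measure) =
    density (distr (lborel :: (real^2) measure) borel (\<lambda>P. (P \<bullet> unit_vec \<phi>1, P \<bullet> unit_vec \<phi>2)))
      (\<lambda>_. ennreal \<bar>sin (\<phi>2 - \<phi>1)\<bar>)" (is "_ = ?D")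
proof (rule lborel_eqI)
  fix l u :: "real \<times> real"
  assume "\<And>b. b \<in> Basis \<Longrightarrow> l \<bullet> b \<le> u \<bullet> b"
  from this[of "(1, 0)"] this[of "(0, 1)"] have le: "fst l \<le> fst u" "snd l \<le> snd u"
    by (auto simp: Basis_prod_def inner_prod_def)
  define T :: "real^2 \<Rightarrow> real^2" where "T P = vector [P \<bullet> unit_vec \<phi>1, P \<bullet> unit_vec \<phi>2]" for P
  have T: "linear T"
    by (rule linearI) (auto simp: T_def vec_eq_iff forall_2 vector_2 inner_simps)
  have det: "det (matrix T) = sin (\<phi>2 - \<phi>1)"
    by (simp add: det_2 matrix_def T_def vector_2 inner_unit_vec axis_def sin_diff)
  have "inj T"
    using det nz T
    by (metis det_nz_iff_inj)
  then obtain g where g: "linear g" "\<And>x. T (g x) = x" "\<And>x. g (T x) = x"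
    using linear_injective_isomorphism[OF T] by blast
  define B :: "(real^2) set" where "B = box (vector [fst l, snd l]) (vector [fst u, snd u])"
  have pre: "(\<lambda>P. (P \<bullet> unit_vec \<phi>1, P \<bullet> unit_vec \<phi>2)) -` box l u = g ` B"
  proof -
    have "(\<lambda>P. (P \<bullet> unit_vec \<phi>1, P \<bullet> unit_vec \<phi>2)) -` box l u = T -` B"
      by (auto simp: B_def T_def mem_box_cart forall_2 vector_2 mem_box Basis_prod_def inner_prod_def)
    also have "\<dots> = g ` B"
      using g(2,3) by (auto simp: image_iff) metis
    finally show ?thesis .
  qed
  have Basis: "(Basis :: (real^2) set) = {axis 1 1, axis 2 1}"
    by (auto simp: Basis_vec_def UNIV_2)
  have neq: "axis 1 1 \<noteq> (axis 2 1 :: real^2)"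
    by (simp add: axis_eq_axis)
  have B: "B \<in> lmeasurable" "measure lebesgue B = (fst u - fst l) * (snd u - snd l)"
    unfolding B_def using le
    by (auto simp: measure_lborel_box_eq Basis neq inner_axis vector_2)
  have gB: "g ` B \<in> lmeasurable" by (rule measurable_linear_image[OF g(1) B(1)])
  have "measure lebesgue (T ` (g ` B)) = \<bar>sin (\<phi>2 - \<phi>1)\<bar> * measure lebesgue (g ` B)"
    using measure_linear_image[OF T gB] det by simp
  then have m: "\<bar>sin (\<phi>2 - \<phi>1)\<bar> * measure lebesgue (g ` B) = (fst u - fst l) * (snd u - snd l)"
    using B(2) g(2) by (simp add: image_image)
  have [measurable]: "g ` B \<in> sets borel"
    unfolding pre[symmetric]
    by (rule measurable_sets_borel[where M=borel], simp add: borel_prod[symmetric], simp)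
  have "emeasure ?D (box l u) = ennreal \<bar>sin (\<phi>2 - \<phi>1)\<bar> * emeasure lborel (g ` B)"
    by (simp add: emeasure_density nn_integral_cmult_indicator emeasure_distr pre)
  also have "emeasure lborel (g ` B) = emeasure lebesgue (g ` B)" by simp
  also have "\<dots> = ennreal (measure lebesgue (g ` B))"
    using gB by (simp add: emeasure_eq_measure2)
  finally show "emeasure ?D (box l u) = (\<Prod>b\<in>Basis. (u - l) \<bullet> b)"
    using m by (simp add: ennreal_mult' [symmetric] Basis_prod_def inner_prod_def mult.commute)
qed simp

lemma AE_sin_diff_nonzero: "AE y in lborel. sin (y - x :: real) \<noteq> 0"
proof -
  have "{y. sin (y - x) = 0} \<subseteq> (\<lambda>i. x + of_int i * pi) ` (UNIV::int set)"
  proof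
    fix y assume "y \<in> {y. sin (y - x) = 0}"
    then obtain i :: int where "y - x = of_int i * pi"
      by (auto simp: sin_zero_iff_int2)
    then have "y = x + of_int i * pi" by simp
    then show "y \<in> (\<lambda>i. x + of_int i * pi) ` (UNIV::int set)" by blast
  qed
  then have "countable {y. sin (y - x) = 0}"
    by (rule countable_subset) simp
  then have "emeasure lborel {y. sin (y - x) = 0} = 0"
    by (rule emeasure_lborel_countable)
  then show ?thesis
    by (intro AE_I[where N="{y. sin (y - x) = 0}"]) auto
qed

lemma nn_integral_lborel_fst:
  fixes q :: "'a::euclidean_space \<times> 'b::euclidean_space \<Rightarrow> ennreal"
  assumes "q \<in> borel_measurable borel"
  shows "(\<integral>\<^sup>+ z. q z \<partial>lborel) = (\<integral>\<^sup>+ x. \<integral>\<^sup>+ y. q (x, y) \<partial>lborel \<partial>lborel)"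
proof -
  have "q \<in> borel_measurable (lborel \<Otimes>\<^sub>M lborel)" using assms by (simp add: lborel_prod)
  from lborel.nn_integral_fst[OF this] show ?thesis by (simp add: lborel_prod)
qed

lemma nn_integral_lborel_snd:
  fixes q :: "'a::euclidean_space \<times> 'b::euclidean_space \<Rightarrow> ennreal"
  assumes "q \<in> borel_measurable borel"
  shows "(\<integral>\<^sup>+ z. q z \<partial>lborel) = (\<integral>\<^sup>+ y. \<integral>\<^sup>+ x. q (x, y) \<partial>lborel \<partial>lborel)"
proof -
  have "(\<lambda>(x, y). q (x, y)) \<in> borel_measurable (lborel \<Otimes>\<^sub>M lborel)" using assms by (simp add: lborel_prod)
  from lborel_pair.nn_integral_snd[OF this] show ?thesis by (simp add: lborel_prod)
qed

text \<open>The distances are signed here, so that the map is defined for all angles; a line has coordinates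
\<open>(p, \<phi>)\<close> only for the normal \<open>\<phi>\<close> that makes \<open>p\<close> positive.\<close>

definition lines_through :: "(real^2) \<times> (real \<times> real) \<Rightarrow> (real \<times> real) \<times> (real \<times> real)"
  where "lines_through = (\<lambda>(P, \<phi>1, \<phi>2). ((P \<bullet> unit_vec \<phi>1, \<phi>1), (P \<bullet> unit_vec \<phi>2, \<phi>2)))"

lemma measurable_lines_through [measurable]: "lines_through \<in> borel \<rightarrow>\<^sub>M borel"
  unfolding lines_through_def by (simp add: borel_prod[symmetric])

text \<open>For nonnegative integrands Tonelli's theorem allows the angles to be brought outside, where the
linear change of variables applies, and the point to be brought outside afterwards.\<close>

lemma nn_integral_line_pairs:
  fixes q :: "(real \<times> real) \<times> (real \<times> real) \<Rightarrow> ennreal"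
  assumes [measurable]: "q \<in> borel_measurable borel"
  shows "(\<integral>\<^sup>+ G. q G \<partial>lborel) =
    (\<integral>\<^sup>+ P. \<integral>\<^sup>+ \<phi>1. \<integral>\<^sup>+ \<phi>2. ennreal \<bar>sin (\<phi>2 - \<phi>1)\<bar> * q (lines_through (P, \<phi>1, \<phi>2)) \<partial>lborel \<partial>lborel \<partial>lborel)"
proof -
  have [measurable]: "q \<in> borel_measurable ((borel \<Otimes>\<^sub>M borel) \<Otimes>\<^sub>M (borel \<Otimes>\<^sub>M borel))"
    using assms by (simp add: borel_prod)
  have q1: "(\<lambda>G2. q (G1, G2)) \<in> borel_measurable borel" for G1
    by (rule measurable_compose[OF borel_measurable_continuous_onI assms]) (intro continuous_intros)
  have "(\<integral>\<^sup>+ G. q G \<partial>lborel) =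
     (\<integral>\<^sup>+ G1. \<integral>\<^sup>+ G2. q (G1, G2) \<partial>lborel \<partial>lborel)"
    by (subst nn_integral_lborel_fst) simp_all
  also have "\<dots> = (\<integral>\<^sup>+ G1. \<integral>\<^sup>+ \<phi>2. \<integral>\<^sup>+ p2. q (G1, (p2, \<phi>2)) \<partial>lborel \<partial>lborel \<partial>lborel)"
    by (intro nn_integral_cong nn_integral_lborel_snd q1)
  also have "\<dots> = (\<integral>\<^sup>+ \<phi>1. \<integral>\<^sup>+ p1. \<integral>\<^sup>+ \<phi>2. \<integral>\<^sup>+ p2. q ((p1, \<phi>1), (p2, \<phi>2)) \<partial>lborel \<partial>lborel \<partial>lborel \<partial>lborel)"
    by (subst nn_integral_lborel_snd) (simp_all add: borel_prod[symmetric])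
  also have "\<dots> = (\<integral>\<^sup>+ \<phi>1. \<integral>\<^sup>+ \<phi>2. \<integral>\<^sup>+ p1. \<integral>\<^sup>+ p2. q ((p1, \<phi>1), (p2, \<phi>2)) \<partial>lborel \<partial>lborel \<partial>lborel \<partial>lborel)"
    by (intro nn_integral_cong lborel_pair.Fubini') (simp add: borel_prod)
  also have "\<dots> = (\<integral>\<^sup>+ \<phi>1. \<integral>\<^sup>+ \<phi>2. \<integral>\<^sup>+ p. q ((fst p, \<phi>1), (snd p, \<phi>2)) \<partial>lborel \<partial>lborel \<partial>lborel)"
    by (subst nn_integral_lborel_fst) (simp_all add: borel_prod[symmetric])
  \<comment> \<open>Parallel lines have no point of intersection, but they form a null set.\<close>
  also have "\<dots> = (\<integral>\<^sup>+ \<phi>1. \<integral>\<^sup>+ \<phi>2. \<integral>\<^sup>+ P. ennreal \<bar>sin (\<phi>2 - \<phi>1)\<bar> * q (lines_through (P, \<phi>1, \<phi>2)) \<partial>lborel \<partial>lborel \<partial>lborel)"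
  proof (rule nn_integral_cong, rule nn_integral_cong_AE)
    fix \<phi>1 :: real
    show "AE \<phi>2 in lborel. (\<integral>\<^sup>+ p. q ((fst p, \<phi>1), (snd p, \<phi>2)) \<partial>lborel) =
       (\<integral>\<^sup>+ P. ennreal \<bar>sin (\<phi>2 - \<phi>1)\<bar> * q (lines_through (P, \<phi>1, \<phi>2)) \<partial>lborel)"
      using AE_sin_diff_nonzero[of \<phi>1]
    proof eventually_elim
      case (elim \<phi>2)
      have [measurable]: "(\<lambda>P. (P \<bullet> unit_vec \<phi>1, P \<bullet> unit_vec \<phi>2)) \<in> borel \<rightarrow>\<^sub>M (borel :: (real\<times>real) measure)"
        by (simp add: borel_prod[symmetric])
      have [measurable]: "(\<lambda>p. q ((fst p, \<phi>1), (snd p, \<phi>2))) \<in> borel_measurable (borel :: (real\<times>real) measure)"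
        by (simp add: borel_prod[symmetric])
      show ?case
        by (subst lborel_two_normals[OF elim])
           (simp add: nn_integral_density nn_integral_distr nn_integral_cmult lines_through_def)
    qed
  qed
  also have "\<dots> = (\<integral>\<^sup>+ \<phi>1. \<integral>\<^sup>+ P. \<integral>\<^sup>+ \<phi>2. ennreal \<bar>sin (\<phi>2 - \<phi>1)\<bar> * q (lines_through (P, \<phi>1, \<phi>2)) \<partial>lborel \<partial>lborel \<partial>lborel)"
    by (intro nn_integral_cong lborel_pair.Fubini') (simp add: borel_prod)
  also have "\<dots> = (\<integral>\<^sup>+ P. \<integral>\<^sup>+ \<phi>1. \<integral>\<^sup>+ \<phi>2. ennreal \<bar>sin (\<phi>2 - \<phi>1)\<bar> * q (lines_through (P, \<phi>1, \<phi>2)) \<partial>lborel \<partial>lborel \<partial>lborel)"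
    by (intro lborel_pair.Fubini') (simp add: borel_prod)
  finally show ?thesis .
qed

text \<open>The change of variables as an identity of measures. In this form it passes to signed integrands
together with their integrability.\<close>

lemma lborel_line_pairs:
  "(lborel :: ((real \<times> real) \<times> (real \<times> real)) measure) =
   distr (density (lborel :: ((real^2) \<times> (real \<times> real)) measure) (\<lambda>(P, \<phi>1, \<phi>2). ennreal \<bar>sin (\<phi>2 - \<phi>1)\<bar>))
     borel lines_through"
proof (rule measure_eqI)
  fix X :: "((real \<times> real) \<times> (real \<times> real)) set"
  assume "X \<in> sets lborel"
  then have [measurable]: "X \<in> sets borel" by simp
  have [measurable]: "(\<lambda>(P, \<phi>1, \<phi>2). ennreal \<bar>sin (\<phi>2 - \<phi>1)\<bar>) \<in> borel_measurable (borel :: ((real^2) \<times> (real \<times> real)) measure)"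
    by (simp add: borel_prod[symmetric])
  let ?s = "\<lambda>z. (case z of (P, \<phi>1, \<phi>2) \<Rightarrow> ennreal \<bar>sin (\<phi>2 - \<phi>1)\<bar>) * indicator X (lines_through z)"
  have "emeasure (distr (density (lborel :: ((real^2) \<times> (real \<times> real)) measure) (\<lambda>(P, \<phi>1, \<phi>2). ennreal \<bar>sin (\<phi>2 - \<phi>1)\<bar>))
     borel lines_through) X = (\<integral>\<^sup>+ z. ?s z \<partial>lborel)"
    using measurable_sets_borel[OF measurable_lines_through \<open>X \<in> sets borel\<close>]
    by (auto simp: emeasure_distr emeasure_density indicator_def intro!: nn_integral_cong)
  also have "\<dots> = (\<integral>\<^sup>+ P. \<integral>\<^sup>+ \<phi>. ?s (P, \<phi>) \<partial>lborel \<partial>lborel)"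
    by (subst nn_integral_lborel_fst) simp_all
  also have "\<dots> = (\<integral>\<^sup>+ P. \<integral>\<^sup>+ \<phi>1. \<integral>\<^sup>+ \<phi>2. ?s (P, \<phi>1, \<phi>2) \<partial>lborel \<partial>lborel \<partial>lborel)"
  proof (intro nn_integral_cong nn_integral_lborel_fst)
    fix P
    have s: "?s \<in> borel_measurable borel" by measurable
    show "(\<lambda>\<phi>. ?s (P, \<phi>)) \<in> borel_measurable borel"
      by (rule measurable_compose[OF _ s]) (simp add: borel_prod[symmetric])
  qed
  also have "\<dots> = (\<integral>\<^sup>+ G. indicator X G \<partial>lborel)"
    by (subst nn_integral_line_pairs) simp_all
  finally show "emeasure lborel X = emeasure (distr (density (lborel :: ((real^2) \<times> (real \<times> real)) measure) (\<lambda>(P, \<phi>1, \<phi>2). ennreal \<bar>sin (\<phi>2 - \<phi>1)\<bar>))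
     borel lines_through) X" by simp
qed simp

section \<open>Integrals over the normals of a pencil of lines\<close>

lemma set_lebesgue_integral_translate:
  fixes q :: "real \<Rightarrow> real"
  shows "(LINT x:{a + t..<b + t}|lborel. q x) = (LINT x:{a..<b}|lborel. q (x + t))"
proof -
  have "(LINT x:{a + t..<b + t}|lborel. q x) =
      (\<integral>x. indicator {a + t..<b + t} (t + 1 * x) *\<^sub>R q (t + 1 * x) \<partial>lborel)"
    unfolding set_lebesgue_integral_def
    by (subst lborel_integral_real_affine[of 1 _ t]) simp_all
  also have "\<dots> = (LINT x:{a..<b}|lborel. q (x + t))"
    unfolding set_lebesgue_integral_def
    by (intro Bochner_Integration.integral_cong) (auto simp: indicator_def add.commute)
  finally show ?thesis .
qed

text \<open>A shift by less than a period only exchanges two intervals that differ by a period.\<close>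

lemma periodic_integral_shift:
  fixes q :: "real \<Rightarrow> real"
  assumes T: "T > 0" and per: "\<And>x. q (x + T) = q x"
    and int: "\<And>a b. set_integrable lborel {a..<b} q"
  shows "(LINT x:{a..<a + T}|lborel. q x) = (LINT x:{0..<T}|lborel. q x)"
proof -
  define G where "G a = (LINT x:{a..<a + T}|lborel. q x)" for a
  have split: "(LINT x:{a..<c}|lborel. q x) = (LINT x:{a..<b}|lborel. q x) + (LINT x:{b..<c}|lborel. q x)"
    if "a \<le> b" "b \<le> c" for a b c
    using set_integral_Un[OF _ int[of a b] int[of b c]] that
    by (simp add: ivl_disj_un_two(3) ivl_disj_int_two(3))
  have tr: "(LINT x:{a + T..<b + T}|lborel. q x) = (LINT x:{a..<b}|lborel. q x)" for a b
    by (simp add: set_lebesgue_integral_translate per)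
  have step: "G (a + T) = G a" for a
    unfolding G_def by (rule tr)
  have near: "G a' = G a" if "a \<le> a'" "a' \<le> a + T" for a a'
    using split[of a a' "a + T"] split[of a' "a + T" "a' + T"] tr[of a a'] that T
    by (simp add: G_def)
  have mult: "G (a + real n * T) = G a" for a n
  proof (induction n)
    case (Suc n)
    have "a + real (Suc n) * T = (a + real n * T) + T" by (simp add: algebra_simps)
    then show ?case by (simp only: step Suc)
  qed simp
  define n where "n = \<lfloor>a / T\<rfloor>"
  have "of_int n * T \<le> a" "a < of_int n * T + T"
    using mult_right_mono[of "of_int n" "a / T" T] mult_strict_right_mono[of "a / T" "of_int n + 1" T]
      floor_correct[of "a / T"] T by (simp_all add: n_def distrib_right)
  then have "G a = G (of_int n * T)"
    by (intro near) auto
  also have "\<dots> = G 0"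
  proof (cases "n \<ge> 0")
    case True
    then show ?thesis using mult[of 0 "nat n"] by simp
  next
    case False
    then show ?thesis using mult[of "of_int n * T" "nat (- n)"] by simp
  qed
  finally show ?thesis by (simp add: G_def)
qed

lemma AE_inner_unit_vec_nonzero:
  assumes "P \<noteq> 0"
  shows "AE \<phi> in lborel. P \<bullet> unit_vec \<phi> \<noteq> 0"
proof -
  obtain t where t: "P = norm P *\<^sub>R unit_vec t" by (rule polar_form)
  have "P \<bullet> unit_vec \<phi> = norm P * sin (\<phi> - (t - pi / 2))" for \<phi>
  proof -
    have "P \<bullet> unit_vec \<phi> = norm P * cos (t - \<phi>)"
      by (subst t) (simp add: inner_unit_vec_unit_vec)
    then show ?thesis
      by (simp add: cos_sin_eq algebra_simps)
  qed
  then show ?thesis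
    using AE_sin_diff_nonzero[of "t - pi / 2"] assms by simp
qed

text \<open>Of the two normals \<open>\<phi>\<close> and \<open>\<phi> + pi\<close> of a line through \<open>P\<close> that avoids the origin, exactly one makes
the distance \<open>P \<bullet> unit_vec \<phi>\<close> positive, and \<open>q\<close> takes the same value at both.\<close>

lemma integral_normals_positive_half:
  fixes q :: "real \<Rightarrow> real"
  assumes P: "P \<noteq> 0" and per: "\<And>x. q (x + pi) = q x"
    and int: "\<And>a b. set_integrable lborel {a..<b} q"
  shows "(LINT \<phi>:{\<phi>\<in>{0..<2 * pi}. 0 < P \<bullet> unit_vec \<phi>}|lborel. q \<phi>) = (LINT \<phi>:{0..<pi}|lborel. q \<phi>)"
proof -
  define H where "H = {\<phi>. 0 < P \<bullet> unit_vec \<phi>}"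
  define r where "r \<phi> = indicator H \<phi> * q \<phi>" for \<phi>
  have [measurable]: "H \<in> sets borel"
    unfolding H_def by measurable
  have ri: "set_integrable lborel {a..<b} r" for a b
    using set_integrable_subset[OF int[of a b], of "{a..<b} \<inter> H"]
    unfolding set_integrable_def r_def by (simp add: indicator_inter_arith mult.assoc)
  have ri': "set_integrable lborel {0..<pi} (\<lambda>\<phi>. r (\<phi> + pi))"
  proof -
    have "integrable lborel (\<lambda>\<phi>. indicator {pi..<2 * pi} (pi + 1 * \<phi>) *\<^sub>R r (pi + 1 * \<phi>))"
      using ri[of pi "2 * pi"] unfolding set_integrable_def
      by (intro lborel_integrable_real_affine) auto
    also have "(\<lambda>\<phi>. indicator {pi..<2 * pi} (pi + 1 * \<phi>) *\<^sub>R r (pi + 1 * \<phi>)) =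
        (\<lambda>\<phi>. indicator {0..<pi} \<phi> *\<^sub>R r (\<phi> + pi))"
      by (auto simp: indicator_def add.commute)
    finally show "set_integrable lborel {0..<pi} (\<lambda>\<phi>. r (\<phi> + pi))"
      unfolding set_integrable_def .
  qed
  have "(LINT \<phi>:{\<phi>\<in>{0..<2 * pi}. 0 < P \<bullet> unit_vec \<phi>}|lborel. q \<phi>) = (LINT \<phi>:{0..<2 * pi}|lborel. r \<phi>)"
    unfolding set_lebesgue_integral_def r_def H_def
    by (intro Bochner_Integration.integral_cong) (auto simp: indicator_def)
  also have "\<dots> = (LINT \<phi>:{0..<pi}|lborel. r \<phi>) + (LINT \<phi>:{pi..<2 * pi}|lborel. r \<phi>)"
    using set_integral_Un[OF _ ri[of 0 pi] ri[of pi "2 * pi"]]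
    by (simp add: ivl_disj_un_two(3) ivl_disj_int_two(3))
  also have "(LINT \<phi>:{pi..<2 * pi}|lborel. r \<phi>) = (LINT \<phi>:{0..<pi}|lborel. r (\<phi> + pi))"
    using set_lebesgue_integral_translate[of 0 pi pi r] by simp
  also have "(LINT \<phi>:{0..<pi}|lborel. r \<phi>) + (LINT \<phi>:{0..<pi}|lborel. r (\<phi> + pi)) =
     (LINT \<phi>:{0..<pi}|lborel. r \<phi> + r (\<phi> + pi))"
    by (rule set_integral_add(2)[OF ri ri', symmetric])
  also have "\<dots> = (LINT \<phi>:{0..<pi}|lborel. q \<phi>)"
  proof -
    have *: "AE \<phi> in lborel. r \<phi> + r (\<phi> + pi) = q \<phi>"
      using AE_inner_unit_vec_nonzero[OF P]
      by eventually_elim (auto simp: r_def H_def indicator_def unit_vec_add_pi per)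
    have m: "set_borel_measurable lborel {0..<pi} h" if "set_integrable lborel {0..<pi} h" for h :: "real \<Rightarrow> real"
      using that unfolding set_integrable_def set_borel_measurable_def by (rule borel_measurable_integrable)
    show ?thesis
      unfolding set_lebesgue_integral_def
      using * m[OF set_integral_add(1)[OF ri ri']] m[OF int] unfolding set_borel_measurable_def
      by (intro integral_cong_AE) auto
  qed
  finally show ?thesis .
qed

text \<open>The set \<open>B\<close> stands for the normal angles of the lines through \<open>P\<close> that meet a convex set. The
intersection with the half-open period on both sides of \<open>arc\<close> lets the case \<open>\<omega> = pi\<close>, in which every
line meets the set, be treated together with the proper arcs.\<close>

lemma integral_normals_of_pencil:
  fixes q :: "real \<Rightarrow> real"
  assumes P: "P \<noteq> 0" and per: "\<And>x. q (x + pi) = q x"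
    and int: "\<And>a b. set_integrable lborel {a..<b} q"
    and B [measurable]: "B \<in> sets borel" and Bper: "\<And>x. x + pi \<in> B \<longleftrightarrow> x \<in> B"
    and arc: "B \<inter> {a..<a + pi} = {a..a + \<omega>} \<inter> {a..<a + pi}" and \<omega>: "0 \<le> \<omega>" "\<omega> \<le> pi"
  shows "(LINT \<phi>:{\<phi>\<in>{0..<2 * pi}. 0 < P \<bullet> unit_vec \<phi> \<and> \<phi> \<in> B}|lborel. q \<phi>) = (LINT \<phi>:{a..a + \<omega>}|lborel. q \<phi>)"
proof -
  define r where "r \<phi> = indicator B \<phi> * q \<phi>" for \<phi>
  have ri: "set_integrable lborel {a..<b} r" for a b
    using set_integrable_subset[OF int[of a b], of "{a..<b} \<inter> B"]
    unfolding set_integrable_def r_def by (simp add: indicator_inter_arith mult.assoc)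
  have rper: "r (x + pi) = r x" for x
    by (simp add: r_def per indicator_def Bper)
  have "(LINT \<phi>:{\<phi>\<in>{0..<2 * pi}. 0 < P \<bullet> unit_vec \<phi> \<and> \<phi> \<in> B}|lborel. q \<phi>) =
      (LINT \<phi>:{\<phi>\<in>{0..<2 * pi}. 0 < P \<bullet> unit_vec \<phi>}|lborel. r \<phi>)"
    unfolding set_lebesgue_integral_def r_def
    by (intro Bochner_Integration.integral_cong) (auto simp: indicator_def)
  also have "\<dots> = (LINT \<phi>:{0..<pi}|lborel. r \<phi>)"
    by (rule integral_normals_positive_half[OF P rper ri])
  also have "\<dots> = (LINT \<phi>:{a..<a + pi}|lborel. r \<phi>)"
    by (rule periodic_integral_shift[OF pi_gt_zero rper ri, symmetric])
  also have "\<dots> = (LINT \<phi>:{a..a + \<omega>} \<inter> {a..<a + pi}|lborel. q \<phi>)"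
    unfolding set_lebesgue_integral_def r_def arc[symmetric]
    by (intro Bochner_Integration.integral_cong) (auto simp: indicator_def)
  also have "\<dots> = (LINT \<phi>:{a..a + \<omega>}|lborel. q \<phi>)"
    by (rule set_integral_discrete_difference[where X = "{a + pi}"]) (use \<omega> in auto)
  finally show ?thesis .
qed

section \<open>The visual angle\<close>

text \<open>The linear functional that supports \<open>K\<close> at \<open>x\<close> is maximal there along the boundary curve, so its
derivative vanishes and the velocity of the curve is a nonzero multiple of \<open>unit_vec \<alpha>\<close>. A linear
change of the parameter turns it into \<open>unit_vec \<alpha>\<close> itself.\<close>

lemma tangent_vector_supporting_line:
  assumes bd: "C2_boundary K" and x: "x \<in> frontier K" and cl: "closed K"
    and supp: "\<And>y. y \<in> K \<Longrightarrow> (y - x) \<bullet> unit_vec (\<alpha> + pi / 2) \<le> 0"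
  shows "tangent_vector (frontier K) x (unit_vec \<alpha>)"
proof -
  obtain \<gamma> \<gamma>' where \<gamma>: "\<And>t. (\<gamma> has_vector_derivative \<gamma>' t) (at t)" "\<And>t. \<gamma>' t \<noteq> 0" "range \<gamma> = frontier K"
    using bd unfolding C2_boundary_def C2_on_def by auto
  obtain t0 where t0: "\<gamma> t0 = x" using x \<gamma>(3) by (metis imageE)
  let ?n = "unit_vec (\<alpha> + pi / 2)"
  have der: "((\<lambda>t. \<gamma> t \<bullet> ?n) has_real_derivative \<gamma>' t0 \<bullet> ?n) (at t0)"
    using bounded_linear.has_vector_derivative[OF bounded_linear_inner_left \<gamma>(1)]
    by (simp add: has_real_derivative_iff_has_vector_derivative)
  have "\<gamma> t \<in> K" for t
    using \<gamma>(3) frontier_subset_closed[OF cl] by blast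
  then have "\<gamma> t \<bullet> ?n \<le> \<gamma> t0 \<bullet> ?n" for t
    using supp[of "\<gamma> t"] by (simp add: t0 inner_diff_left)
  then have "\<gamma>' t0 \<bullet> ?n = 0"
    using DERIV_local_max[OF der zero_less_one] by simp
  then have dir: "\<gamma>' t0 = (\<gamma>' t0 \<bullet> unit_vec \<alpha>) *\<^sub>R unit_vec \<alpha>"
    using unit_vec_decomp[of "\<gamma>' t0" \<alpha>] by simp
  define c where "c = \<gamma>' t0 \<bullet> unit_vec \<alpha>"
  have c: "c \<noteq> 0" "\<gamma>' t0 = c *\<^sub>R unit_vec \<alpha>"
    using dir \<gamma>(2)[of t0] by (auto simp: c_def)
  have aff: "((\<lambda>s. t0 + s / c) has_vector_derivative 1 / c) (at 0)"
    using c(1) by (auto intro!: derivative_eq_intros simp flip: has_real_derivative_iff_has_vector_derivative)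
  have "((\<gamma> \<circ> (\<lambda>s. t0 + s / c)) has_vector_derivative ((1 / c) *\<^sub>R \<gamma>' t0)) (at 0)"
    using vector_diff_chain_at[OF aff, of \<gamma> "\<gamma>' t0"] \<gamma>(1)[of t0] by simp
  then show ?thesis
    unfolding tangent_vector_def
    by (intro exI[of _ "\<gamma> \<circ> (\<lambda>s. t0 + s / c)"]) (use c t0 \<gamma>(3) in auto)
qed

lemma tangent_vector_uminus:
  assumes "tangent_vector S x v"
  shows "tangent_vector S x (- v)"
proof -
  obtain c where c: "c 0 = x" "range c \<subseteq> S" "(c has_vector_derivative v) (at 0)"
    using assms by (auto simp: tangent_vector_def)
  have "((c \<circ> uminus) has_vector_derivative ((-1) *\<^sub>R v)) (at 0)"
    by (rule vector_diff_chain_at) (use c(3) in \<open>auto intro!: derivative_eq_intros\<close>)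
  then show ?thesis
    unfolding tangent_vector_def using c(1,2) by (intro exI[of _ "c \<circ> uminus"]) auto
qed

lemma frontier_of_supporting_line:
  fixes K :: "'a::euclidean_space set"
  assumes "x \<in> K" "n \<noteq> 0" and supp: "\<And>y. y \<in> K \<Longrightarrow> (y - x) \<bullet> n \<le> 0"
  shows "x \<in> frontier K"
proof -
  have "K \<subseteq> {y. n \<bullet> y \<le> n \<bullet> x}"
    using supp by (auto simp: inner_diff_left inner_commute[of n])
  then have "interior K \<subseteq> {y. n \<bullet> y < n \<bullet> x}"
    using interior_mono interior_halfspace_le[OF \<open>n \<noteq> 0\<close>] by blast
  then have "x \<notin> interior K" by auto
  then show ?thesis
    using \<open>x \<in> K\<close> closure_subset by (auto simp: frontier_def)
qed

lemma polar_in_half_plane: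
  assumes "0 < v \<bullet> unit_vec \<theta>"
  obtains r s where "0 < r" "v = r *\<^sub>R unit_vec (\<theta> + s)" "- (pi / 2) < s" "s < pi / 2"
    "s = arctan ((v \<bullet> unit_vec (\<theta> + pi / 2)) / (v \<bullet> unit_vec \<theta>))"
proof -
  define a where "a = v \<bullet> unit_vec \<theta>"
  define b where "b = v \<bullet> unit_vec (\<theta> + pi / 2)"
  define s where "s = arctan (b / a)"
  have a: "a > 0" using assms by (simp add: a_def)
  have s: "- (pi / 2) < s" "s < pi / 2" "tan s = b / a"
    using arctan[of "b / a"] by (auto simp: s_def)
  have cs: "cos s > 0" using s by (intro cos_gt_zero_pi) auto
  define r where "r = a / cos s"
  have ab: "a = r * cos s" "b = r * sin s"
    using s(3) a cs by (simp_all add: r_def tan_def field_simps)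
  have "\<theta> + s - (\<theta> + pi / 2) = s - pi / 2" by simp
  then have "unit_vec (\<theta> + s) \<bullet> unit_vec (\<theta> + pi / 2) = sin s"
    unfolding inner_unit_vec_unit_vec by (simp add: cos_diff)
  moreover have "unit_vec (\<theta> + s) \<bullet> unit_vec \<theta> = cos s"
    unfolding inner_unit_vec_unit_vec by simp
  ultimately have u: "unit_vec (\<theta> + s) = cos s *\<^sub>R unit_vec \<theta> + sin s *\<^sub>R unit_vec (\<theta> + pi / 2)"
    using unit_vec_decomp[of "unit_vec (\<theta> + s)" \<theta>] by metis
  have "v = a *\<^sub>R unit_vec \<theta> + b *\<^sub>R unit_vec (\<theta> + pi / 2)"
    unfolding a_def b_def by (rule unit_vec_decomp)
  also have "\<dots> = r *\<^sub>R unit_vec (\<theta> + s)"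
    unfolding ab u by (simp add: scaleR_add_right)
  finally have v: "v = r *\<^sub>R unit_vec (\<theta> + s)" .
  have "0 < r" using a cs by (simp add: r_def)
  then show thesis using v s(1,2) s_def[unfolded a_def b_def] by (rule that)
qed

text \<open>A line separating \<open>P\<close> from \<open>K\<close> puts \<open>K\<close> into an open half-plane as seen from \<open>P\<close>, where the polar
angle about \<open>P\<close> is a continuous function. Its minimum and maximum over \<open>K\<close> bound the sector, and the
rays through the points where they are attained support \<open>K\<close>, hence are tangent to it.\<close>

lemma visual_sector_exists:
  assumes comp: "compact K" and conv: "convex K" and int: "interior K \<noteq> {}" and bd: "C2_boundary K" and P: "P \<notin> K"
  obtains \<alpha> \<omega> where "0 < \<omega>" "\<omega> < pi" "K \<subseteq> sector P \<alpha> \<omega>" "tangent_from K P \<alpha>" "tangent_from K P (\<alpha> + \<omega>)"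
proof -
  have cl: "closed K" using comp by (rule compact_imp_closed)
  have ne: "K \<noteq> {}" using int by auto
  obtain n b where n: "n \<bullet> P < b" "\<And>x. x \<in> K \<Longrightarrow> b < n \<bullet> x"
    using separating_hyperplane_closed_point[OF conv cl P] by blast
  have pos: "0 < (x - P) \<bullet> n" if "x \<in> K" for x
    using n(1) n(2)[OF that] by (simp add: inner_diff_left inner_commute[of n])
  have "n \<noteq> 0" using pos ne by fastforce
  then have \<rho>: "0 < norm n" by simp
  obtain \<theta> where "n = norm n *\<^sub>R unit_vec \<theta>" by (rule polar_form)
  then have front: "0 < (x - P) \<bullet> unit_vec \<theta>" if "x \<in> K" for x
    using pos[OF that] \<rho> by (metis inner_scaleR_right zero_less_mult_pos)
  \<comment> \<open>The polar angle of \<open>x\<close> about \<open>P\<close>, measured from the direction \<open>\<theta>\<close>.\<close>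
  define s where "s x = arctan (((x - P) \<bullet> unit_vec (\<theta> + pi / 2)) / ((x - P) \<bullet> unit_vec \<theta>))" for x
  have cont: "continuous_on K s"
  proof -
    have "(x - P) \<bullet> unit_vec \<theta> \<noteq> 0" if "x \<in> K" for x
      using front[OF that] by simp
    then show ?thesis
      unfolding s_def by (intro continuous_intros) blast
  qed
  obtain x1 where x1: "x1 \<in> K" "\<And>x. x \<in> K \<Longrightarrow> s x1 \<le> s x"
    using continuous_attains_inf[OF comp ne cont] by blast
  obtain x2 where x2: "x2 \<in> K" "\<And>x. x \<in> K \<Longrightarrow> s x \<le> s x2"
    using continuous_attains_sup[OF comp ne cont] by blast
  have polar: "\<exists>r>0. x - P = r *\<^sub>R unit_vec (\<theta> + s x)" "- (pi / 2) < s x" "s x < pi / 2" if xK: "x \<in> K" for x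
  proof -
    obtain r t where "0 < r" "x - P = r *\<^sub>R unit_vec (\<theta> + t)" "- (pi / 2) < t" "t < pi / 2" "t = s x"
      unfolding s_def by (rule polar_in_half_plane[OF front[OF xK]])
    then show "\<exists>r>0. x - P = r *\<^sub>R unit_vec (\<theta> + s x)" "- (pi / 2) < s x" "s x < pi / 2"
      by blast+
  qed
  define \<alpha> where "\<alpha> = \<theta> + s x1"
  define \<omega> where "\<omega> = s x2 - s x1"
  have \<alpha>\<omega>: "\<theta> + s x2 = \<alpha> + \<omega>" by (simp add: \<alpha>_def \<omega>_def)
  have "\<omega> < pi" using polar(3)[OF x2(1)] polar(2)[OF x1(1)] by (simp add: \<omega>_def)
  have side: "(x - P) \<bullet> unit_vec (\<theta> + t + pi / 2) = r * sin (s x - t)" if "x - P = r *\<^sub>R unit_vec (\<theta> + s x)" for x r t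
  proof -
    have "(x - P) \<bullet> unit_vec (\<theta> + t + pi / 2) = r * cos (s x - t - pi / 2)"
      by (simp add: that inner_unit_vec_unit_vec algebra_simps)
    then show ?thesis by (simp add: cos_diff)
  qed
  have left: "0 \<le> (x - P) \<bullet> unit_vec (\<alpha> + pi / 2)" and right: "(x - P) \<bullet> unit_vec (\<alpha> + \<omega> + pi / 2) \<le> 0" if x: "x \<in> K" for x
  proof -
    obtain r where r: "r > 0" "x - P = r *\<^sub>R unit_vec (\<theta> + s x)" using polar(1)[OF x] by blast
    have "0 \<le> sin (s x - s x1)" "0 \<le> sin (s x2 - s x)"
      using polar(2,3)[OF x] polar(2,3)[OF x1(1)] polar(2,3)[OF x2(1)] x1(2)[OF x] x2(2)[OF x]
      by (intro sin_ge_zero; simp)+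
    moreover have "sin (s x - s x2) = - sin (s x2 - s x)" by (simp flip: sin_minus)
    ultimately show "0 \<le> (x - P) \<bullet> unit_vec (\<alpha> + pi / 2)" "(x - P) \<bullet> unit_vec (\<alpha> + \<omega> + pi / 2) \<le> 0"
      using side[OF r(2), of "s x1"] side[OF r(2), of "s x2"] r(1) \<alpha>\<omega>
      by (simp_all add: \<alpha>_def mult_nonneg_nonpos)
  qed
  obtain r1 where r1: "r1 > 0" "x1 - P = r1 *\<^sub>R unit_vec \<alpha>" using polar(1)[OF x1(1)] by (auto simp: \<alpha>_def)
  obtain r2 where r2: "r2 > 0" "x2 - P = r2 *\<^sub>R unit_vec (\<alpha> + \<omega>)" using polar(1)[OF x2(1)] \<alpha>\<omega> by auto
  have on1: "(x1 - P) \<bullet> unit_vec (\<alpha> + pi / 2) = 0" and on2: "(x2 - P) \<bullet> unit_vec (\<alpha> + \<omega> + pi / 2) = 0"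
    by (simp_all add: r1 r2 inner_unit_vec_unit_vec)
  have unz: "unit_vec t \<noteq> 0" for t using norm_unit_vec[of t] by auto
  have supp1: "(y - x1) \<bullet> unit_vec (\<alpha> + pi + pi / 2) \<le> 0" if "y \<in> K" for y
    using left[OF that] on1 unit_vec_add_pi[of "\<alpha> + pi / 2"]
    by (simp add: inner_diff_left add.commute add.left_commute)
  have supp2: "(y - x2) \<bullet> unit_vec (\<alpha> + \<omega> + pi / 2) \<le> 0" if "y \<in> K" for y
    using right[OF that] on2 by (simp add: inner_diff_left)
  have fr1: "x1 \<in> frontier K" by (rule frontier_of_supporting_line[OF x1(1) unz supp1])
  have fr2: "x2 \<in> frontier K" by (rule frontier_of_supporting_line[OF x2(1) unz supp2])
  have t1: "tangent_vector (frontier K) x1 (unit_vec \<alpha>)"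
    using tangent_vector_uminus[OF tangent_vector_supporting_line[OF bd fr1 cl supp1]] by (simp add: unit_vec_add_pi)
  have t2: "tangent_vector (frontier K) x2 (unit_vec (\<alpha> + \<omega>))"
    by (rule tangent_vector_supporting_line[OF bd fr2 cl supp2])
  have x1': "x1 = P + r1 *\<^sub>R unit_vec \<alpha>" and x2': "x2 = P + r2 *\<^sub>R unit_vec (\<alpha> + \<omega>)"
    using r1(2) r2(2) by (simp_all add: algebra_simps)
  have tf: "tangent_from K P \<alpha>" "tangent_from K P (\<alpha> + \<omega>)"
    using r1(1) r2(1) fr1 fr2 t1 t2 unfolding tangent_from_def x1' x2' by blast+
  have sec: "K \<subseteq> sector P \<alpha> \<omega>"
  proof
    fix x assume x: "x \<in> K"
    obtain r where r: "r > 0" "x - P = r *\<^sub>R unit_vec (\<theta> + s x)" using polar(1)[OF x] by blast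
    then have "x = P + r *\<^sub>R unit_vec (\<theta> + s x)" by (simp add: algebra_simps)
    moreover have "\<alpha> \<le> \<theta> + s x" "\<theta> + s x \<le> \<alpha> + \<omega>"
      using x1(2)[OF x] x2(2)[OF x] by (simp_all add: \<alpha>_def \<omega>_def)
    ultimately show "x \<in> sector P \<alpha> \<omega>"
      unfolding sector_def using r(1) by (intro CollectI exI[of _ r] exI[of _ "\<theta> + s x"]) auto
  qed
  \<comment> \<open>If \<open>\<omega>\<close> were zero, \<open>K\<close> would lie on a line.\<close>
  have "0 < \<omega>"
  proof (rule ccontr)
    assume "\<not> 0 < \<omega>"
    then have "\<omega> = 0" using x1(2)[OF x2(1)] by (simp add: \<omega>_def)
    then have "K \<subseteq> {x. unit_vec (\<alpha> + pi / 2) \<bullet> x = unit_vec (\<alpha> + pi / 2) \<bullet> P}"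
    proof (intro subsetI CollectI)
      fix x assume "x \<in> K"
      then have "(x - P) \<bullet> unit_vec (\<alpha> + pi / 2) = 0"
        using left[of x] right[of x] \<open>\<omega> = 0\<close> by simp
      then show "unit_vec (\<alpha> + pi / 2) \<bullet> x = unit_vec (\<alpha> + pi / 2) \<bullet> P"
        by (simp add: inner_diff_left inner_commute[of "unit_vec (\<alpha> + pi / 2)"])
    qed
    then have "interior K = {}"
      using interior_mono interior_hyperplane[OF unz] by blast
    with int show False by simp
  qed
  show thesis by (rule that[OF \<open>0 < \<omega>\<close> \<open>\<omega> < pi\<close> sec tf])
qed

lemma unit_vec_parallel_pos:
  assumes "r *\<^sub>R unit_vec a = r' *\<^sub>R unit_vec b" "0 < r" "0 \<le> r'"
  obtains k :: int where "a = b + 2 * of_int k * pi"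
proof -
  have "norm (r *\<^sub>R unit_vec a) = norm (r' *\<^sub>R unit_vec b)" using assms(1) by simp
  then have "r = r'" using assms(2,3) by (simp add: norm_unit_vec)
  then have "unit_vec a = unit_vec b" using assms(1,2) by simp
  then have "cos a = cos b \<and> sin a = sin b"
    by (simp add: unit_vec_def vec_eq_iff forall_2 vector_2)
  then obtain k :: int where "a = b + 2 * pi * of_int k"
    using sin_cos_eq_iff[of a b] by blast
  then show thesis by (intro that[of k]) (simp add: mult.commute mult.left_commute)
qed

text \<open>A sector containing \<open>K\<close> contains the points of contact of the two tangents, hence their directions
modulo \<open>2 * pi\<close>. All angles are less than \<open>pi\<close>, so both directions are met in the same period.\<close>

lemma sector_angle_le:
  assumes cl: "closed K" and "K \<subseteq> sector P \<alpha>' \<omega>'" "tangent_from K P \<alpha>" "tangent_from K P (\<alpha> + \<omega>)"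
    and "0 < \<omega>" "\<omega> < pi" "\<omega>' < pi"
  shows "\<omega> \<le> \<omega>'"
proof -
  have dir: "\<exists>k::int. \<alpha>' \<le> \<beta> + 2 * of_int k * pi \<and> \<beta> + 2 * of_int k * pi \<le> \<alpha>' + \<omega>'" if tb: "tangent_from K P \<beta>" for \<beta>
  proof -
    obtain r where r: "r > 0" "P + r *\<^sub>R unit_vec \<beta> \<in> frontier K" using tb by (auto simp: tangent_from_def)
    then have "P + r *\<^sub>R unit_vec \<beta> \<in> sector P \<alpha>' \<omega>'"
      using frontier_subset_closed[OF cl] assms(2) by blast
    then obtain r' \<theta> where r': "r *\<^sub>R unit_vec \<beta> = r' *\<^sub>R unit_vec \<theta>" "0 \<le> r'" "\<alpha>' \<le> \<theta>" "\<theta> \<le> \<alpha>' + \<omega>'"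
      by (auto simp: sector_def)
    obtain k :: int where "\<beta> = \<theta> + 2 * of_int k * pi"
      by (rule unit_vec_parallel_pos[OF r'(1) r(1) r'(2)])
    then show ?thesis using r'(3,4) by (intro exI[of _ "- k"]) simp
  qed
  obtain j :: int where j: "\<alpha>' \<le> \<alpha> + 2 * of_int j * pi" "\<alpha> + 2 * of_int j * pi \<le> \<alpha>' + \<omega>'"
    using dir[OF assms(3)] by blast
  obtain k :: int where k: "\<alpha>' \<le> \<alpha> + \<omega> + 2 * of_int k * pi" "\<alpha> + \<omega> + 2 * of_int k * pi \<le> \<alpha>' + \<omega>'"
    using dir[OF assms(4)] by blast
  define m where "m = k - j"
  have le: "\<omega> + 2 * (of_int m * pi) \<le> \<omega>'" "- \<omega> - 2 * (of_int m * pi) \<le> \<omega>'"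
    using j k by (auto simp: m_def algebra_simps)
  have "m = 0"
  proof (rule ccontr)
    assume "m \<noteq> 0"
    then have "m \<ge> 1 \<or> m \<le> - 1" by linarith
    then have "of_int m \<ge> (1 :: real) \<or> of_int m \<le> (- 1 :: real)" by linarith
    then have "1 * pi \<le> of_int m * pi \<or> of_int m * pi \<le> (- 1) * pi"
      using pi_ge_zero mult_right_mono by blast
    then show False using le assms(5-7) by linarith
  qed
  then show ?thesis using le by simp
qed

lemma visual_angle_eq:
  assumes cl: "closed K" and \<omega>: "0 < \<omega>" "\<omega> < pi" and sec: "K \<subseteq> sector P \<alpha> \<omega>"
    and tf: "tangent_from K P \<alpha>" "tangent_from K P (\<alpha> + \<omega>)"
  shows "visual_angle K P = \<omega>"
  unfolding visual_angle_def
proof (rule the_equality)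
  show "0 < \<omega> \<and> \<omega> < pi \<and> (\<exists>\<alpha>. K \<subseteq> sector P \<alpha> \<omega> \<and> tangent_from K P \<alpha> \<and> tangent_from K P (\<alpha> + \<omega>))"
    using assms by blast
next
  fix \<omega>' assume "0 < \<omega>' \<and> \<omega>' < pi \<and> (\<exists>\<alpha>. K \<subseteq> sector P \<alpha> \<omega>' \<and> tangent_from K P \<alpha> \<and> tangent_from K P (\<alpha> + \<omega>'))"
  then obtain \<alpha>' where *: "0 < \<omega>'" "\<omega>' < pi" "K \<subseteq> sector P \<alpha>' \<omega>'" "tangent_from K P \<alpha>'" "tangent_from K P (\<alpha>' + \<omega>')"
    by blast
  show "\<omega>' = \<omega>"
    using sector_angle_le[OF cl *(3) tf \<omega> *(2)] sector_angle_le[OF cl sec *(4,5,1,2) \<omega>(2)] by simp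
qed

text \<open>These are the normal angles of the lines through \<open>P\<close> that meet \<open>K\<close>. Both normals of a line are
counted, which makes the set \<open>pi\<close>-periodic.\<close>

definition pencil :: "(real^2) set \<Rightarrow> real^2 \<Rightarrow> real set"
  where "pencil K P = {\<phi>. \<exists>x\<in>K. x \<bullet> unit_vec \<phi> = P \<bullet> unit_vec \<phi>}"

text \<open>The angle \<open>\<alpha> + pi / 2 + \<psi>\<close> is normal to the direction \<open>\<alpha> + \<psi>\<close>. Lines in a direction outside
the sector miss \<open>K\<close>. A line in a direction inside it has the two points of contact on
opposite closed sides, so it meets the segment between them.\<close>

lemma pencil_arc:
  assumes cl: "closed K" and conv: "convex K" and P: "P \<notin> K" and \<omega>: "0 < \<omega>" "\<omega> < pi" and sec: "K \<subseteq> sector P \<alpha> \<omega>"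
    and tf: "tangent_from K P \<alpha>" "tangent_from K P (\<alpha> + \<omega>)"
  shows "pencil K P \<inter> {\<alpha> + pi / 2..<\<alpha> + pi / 2 + pi} = {\<alpha> + pi / 2..\<alpha> + pi / 2 + \<omega>}"
proof (intro set_eqI iffI)
  fix \<phi> assume \<phi>: "\<phi> \<in> pencil K P \<inter> {\<alpha> + pi / 2..<\<alpha> + pi / 2 + pi}"
  define \<psi> where "\<psi> = \<phi> - \<alpha> - pi / 2"
  obtain x where x: "x \<in> K" "x \<bullet> unit_vec \<phi> = P \<bullet> unit_vec \<phi>" using \<phi> by (auto simp: pencil_def)
  obtain r \<theta> where r: "x = P + r *\<^sub>R unit_vec \<theta>" "0 \<le> r" "\<alpha> \<le> \<theta>" "\<theta> \<le> \<alpha> + \<omega>"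
    using sec x(1) by (auto simp: sector_def)
  have "r \<noteq> 0" using r(1) x(1) P by auto
  then have "cos (\<theta> - \<phi>) = 0" using x(2) by (simp add: r(1) inner_add_left inner_unit_vec_unit_vec)
  moreover have "cos (\<theta> - \<phi>) = sin (\<theta> - \<alpha> - \<psi>)"
  proof -
    have "\<theta> - \<phi> = (\<theta> - \<alpha> - \<psi>) - pi / 2" by (simp add: \<psi>_def)
    then show ?thesis by (simp only: cos_diff[of _ "pi / 2"]) simp
  qed
  ultimately have "sin (\<theta> - \<alpha> - \<psi>) = 0" by simp
  moreover have "- pi < \<theta> - \<alpha> - \<psi>" "\<theta> - \<alpha> - \<psi> < pi"
    using \<phi> r \<omega> by (auto simp: \<psi>_def)
  ultimately have "\<theta> - \<alpha> - \<psi> = 0" using sin_eq_0_pi by blast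
  then show "\<phi> \<in> {\<alpha> + pi / 2..\<alpha> + pi / 2 + \<omega>}" using \<phi> r(4) by (auto simp: \<psi>_def)
next
  fix \<phi> assume \<phi>: "\<phi> \<in> {\<alpha> + pi / 2..\<alpha> + pi / 2 + \<omega>}"
  define \<psi> where "\<psi> = \<phi> - \<alpha> - pi / 2"
  have \<psi>: "0 \<le> \<psi>" "\<psi> \<le> \<omega>" "\<phi> = \<alpha> + \<psi> + pi / 2" using \<phi> by (auto simp: \<psi>_def)
  obtain r1 where r1: "r1 > 0" "P + r1 *\<^sub>R unit_vec \<alpha> \<in> K"
    using tf(1) frontier_subset_closed[OF cl] by (auto simp: tangent_from_def)
  obtain r2 where r2: "r2 > 0" "P + r2 *\<^sub>R unit_vec (\<alpha> + \<omega>) \<in> K"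
    using tf(2) frontier_subset_closed[OF cl] by (auto simp: tangent_from_def)
  define a where "a = r1 * sin \<psi>"
  define b where "b = r2 * sin (\<omega> - \<psi>)"
  have "cos (\<alpha> - \<phi>) = - sin \<psi>" "cos (\<alpha> + \<omega> - \<phi>) = sin (\<omega> - \<psi>)"
  proof -
    have "\<alpha> - \<phi> = - (\<psi> + pi / 2)" "\<alpha> + \<omega> - \<phi> = (\<omega> - \<psi>) - pi / 2"
      using \<psi>(3) by simp_all
    then show "cos (\<alpha> - \<phi>) = - sin \<psi>" "cos (\<alpha> + \<omega> - \<phi>) = sin (\<omega> - \<psi>)"
      by (simp_all only: cos_minus cos_add cos_diff[of _ "pi / 2"]) simp_all
  qed
  then have v: "unit_vec \<alpha> \<bullet> unit_vec \<phi> = - sin \<psi>" "unit_vec (\<alpha> + \<omega>) \<bullet> unit_vec \<phi> = sin (\<omega> - \<psi>)"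
    by (simp_all add: inner_unit_vec_unit_vec)
  have "0 \<le> sin \<psi>" "0 \<le> sin (\<omega> - \<psi>)" using \<psi> \<omega> by (auto intro!: sin_ge_zero)
  then have ab: "0 \<le> a" "0 \<le> b" using r1 r2 by (auto simp: a_def b_def)
  let ?x1 = "P + r1 *\<^sub>R unit_vec \<alpha>" and ?x2 = "P + r2 *\<^sub>R unit_vec (\<alpha> + \<omega>)"
  \<comment> \<open>The signed distances of the points of contact from the line are \<open>- a\<close> and \<open>b\<close>.\<close>
  have "\<exists>u v. 0 \<le> u \<and> 0 \<le> v \<and> u + v = 1 \<and> v * b = u * a"
  proof (cases "a + b = 0")
    case True
    with ab have "a = 0" "b = 0" by auto
    then show ?thesis by (intro exI[of _ 1] exI[of _ 0]) simp
  next
    case False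
    with ab have "0 \<le> b / (a + b) \<and> 0 \<le> a / (a + b) \<and> b / (a + b) + a / (a + b) = 1
        \<and> a / (a + b) * b = b / (a + b) * a"
      by (simp add: add_divide_distrib[symmetric] add.commute)
    then show ?thesis by blast
  qed
  then obtain u w where uw: "0 \<le> u" "0 \<le> w" "u + w = 1" "w * b = u * a" by blast
  define x where "x = u *\<^sub>R ?x1 + w *\<^sub>R ?x2"
  have "x \<in> K" unfolding x_def by (rule convexD[OF conv r1(2) r2(2) uw(1-3)])
  moreover have "x \<bullet> unit_vec \<phi> = P \<bullet> unit_vec \<phi>"
  proof -
    have "x \<bullet> unit_vec \<phi> = (u + w) * (P \<bullet> unit_vec \<phi>) - u * a + w * b"
      by (simp add: x_def inner_add_left v a_def b_def algebra_simps)
    then show ?thesis using uw by simp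
  qed
  ultimately show "\<phi> \<in> pencil K P \<inter> {\<alpha> + pi / 2..<\<alpha> + pi / 2 + pi}"
    using \<phi> \<omega> by (auto simp: pencil_def)
qed

lemma pencil_visual_angle:
  assumes comp: "compact K" and conv: "convex K" and int: "interior K \<noteq> {}" and bd: "C2_boundary K" and P: "P \<notin> K"
  obtains a where "0 < visual_angle K P" "visual_angle K P < pi"
    "pencil K P \<inter> {a..<a + pi} = {a..a + visual_angle K P}"
proof -
  obtain \<alpha> \<omega> where *: "0 < \<omega>" "\<omega> < pi" "K \<subseteq> sector P \<alpha> \<omega>" "tangent_from K P \<alpha>" "tangent_from K P (\<alpha> + \<omega>)"
    by (rule visual_sector_exists[OF assms])
  have cl: "closed K" using comp by (rule compact_imp_closed)
  show thesis
    using that[of "\<alpha> + pi / 2"] visual_angle_eq[OF cl *] pencil_arc[OF cl conv P *] * by simp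
qed

lemma pencil_periodic: "\<phi> + pi \<in> pencil K P \<longleftrightarrow> \<phi> \<in> pencil K P"
  by (simp add: pencil_def unit_vec_add_pi)

lemma pencil_of_mem: "P \<in> K \<Longrightarrow> pencil K P = UNIV"
  by (auto simp: pencil_def)

section \<open>The second antiderivative of the kernel\<close>

lemma DERIV_imp_vector_within:
  "(h has_real_derivative d) (at x) \<Longrightarrow> (h has_vector_derivative d) (at x within S)"
  by (simp add: has_real_derivative_iff_has_vector_derivative has_vector_derivative_at_within)

lemma C2_on_subset:
  assumes "C2_on S h h' h''" "T \<subseteq> S"
  shows "C2_on T h h' h''"
  unfolding C2_on_def
proof (intro conjI ballI)
  fix x assume "x \<in> T"
  then have "x \<in> S" using assms(2) by auto
  then have "(h has_vector_derivative h' x) (at x within S)" "(h' has_vector_derivative h'' x) (at x within S)"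
    using assms(1) by (auto simp: C2_on_def)
  then show "(h has_vector_derivative h' x) (at x within T)" "(h' has_vector_derivative h'' x) (at x within T)"
    using has_vector_derivative_within_subset[OF _ assms(2)] by blast+
next
  show "continuous_on T h''"
    using assms continuous_on_subset unfolding C2_on_def by blast
qed

lemma C2_on_unique:
  fixes H G :: "real \<Rightarrow> real"
  assumes H: "C2_on {0..c} H H' H''" and G: "C2_on {0..c} G G' G''"
    and eq: "\<And>x. x \<in> {0..c} \<Longrightarrow> H'' x = G'' x" and "H 0 = G 0" "H' 0 = G' 0" and x: "x \<in> {0..c}"
  shows "H x = G x"
proof -
  have d1: "((\<lambda>x. H' x - G' x) has_derivative (\<lambda>h. 0)) (at y within {0..c})" if "y \<in> {0..c}" for y
    using has_vector_derivative_diff[of H' "H'' y" "at y within {0..c}" G' "G'' y"] H G eq that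
    by (simp add: C2_on_def has_vector_derivative_def)
  have 1: "H' y = G' y" if "y \<in> {0..c}" for y
    using has_derivative_zero_unique[OF _ d1, of y 0] that assms(5) by fastforce
  have d0: "((\<lambda>x. H x - G x) has_derivative (\<lambda>h. 0)) (at y within {0..c})" if "y \<in> {0..c}" for y
    using has_vector_derivative_diff[of H "H' y" "at y within {0..c}" G "G' y"] H G 1 that
    by (simp add: C2_on_def has_vector_derivative_def)
  show ?thesis
    using has_derivative_zero_unique[OF _ d0, of x 0] x assms(4) by fastforce
qed

lemma continuous_antiderivative_at_zero:
  fixes g :: "real \<Rightarrow> real"
  assumes "continuous_on UNIV g"
  obtains G where "G 0 = 0" "\<And>x. (G has_real_derivative g x) (at x)"
proof -
  have "\<exists>F. \<forall>x :: real. -\<infinity> < ereal x \<longrightarrow> ereal x < \<infinity> \<longrightarrow> (F has_vector_derivative g x) (at x)"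
    by (rule einterval_antiderivative) (use assms in \<open>auto simp: continuous_on_eq_continuous_at\<close>)
  then obtain F where F: "\<And>x. (F has_real_derivative g x) (at x)"
    by (auto simp: has_real_derivative_iff_has_vector_derivative)
  show thesis
    by (rule that[of "\<lambda>x. F x - F 0"]) (auto intro!: derivative_eq_intros F)
qed

lemma set_integral_FTC:
  fixes q :: "real \<Rightarrow> real"
  assumes "a \<le> b" and "\<And>x. (F has_real_derivative q x) (at x)" and "continuous_on UNIV q"
  shows "(LINT x:{a..b}|lborel. q x) = F b - F a"
  unfolding set_lebesgue_integral_def
  by (rule integral_FTC_atLeastAtMost)
     (use assms in \<open>auto simp: has_real_derivative_iff_has_vector_derivative
        intro: has_vector_derivative_at_within continuous_on_subset\<close>)

lemma integral_difference_kernel: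
  fixes g :: "real \<Rightarrow> real"
  assumes g: "continuous_on UNIV g" and G: "\<And>x. (G has_real_derivative g x) (at x)" and "0 \<le> \<omega>"
  shows "(LINT y:{a..a + \<omega>}|lborel. g (y - x)) = G (a + \<omega> - x) - G (a - x)"
proof -
  have dG: "((\<lambda>y. G (y - x)) has_real_derivative g (y - x)) (at y)" for y
    using DERIV_chain2[OF G DERIV_diff[OF DERIV_ident DERIV_const], of x y UNIV] by simp
  show ?thesis
    using assms
    by (intro set_integral_FTC) (auto intro!: continuous_intros continuous_on_compose2[OF g] dG)
qed

lemma double_integral_difference_kernel:
  fixes g :: "real \<Rightarrow> real"
  assumes g: "continuous_on UNIV g"
    and G: "\<And>x. (G has_real_derivative g x) (at x)"
    and J: "\<And>x. (J has_real_derivative G x) (at x)" "J 0 = 0"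
    and "0 \<le> \<omega>"
  shows "(LINT x:{a..a + \<omega>}|lborel. LINT y:{a..a + \<omega>}|lborel. g (y - x)) = J \<omega> + J (- \<omega>)"
proof -
  have contG: "continuous_on UNIV G"
    using G by (meson DERIV_isCont continuous_at_imp_continuous_on)
  have dJ: "((\<lambda>y. J (c - y)) has_real_derivative - G (c - y)) (at y)" for c y
    using DERIV_chain2[OF J(1) DERIV_diff[OF DERIV_const DERIV_ident], of c y UNIV] by simp
  have inner: "(LINT y:{a..a + \<omega>}|lborel. g (y - x)) = G (a + \<omega> - x) - G (a - x)" for x
    by (rule integral_difference_kernel[OF g G \<open>0 \<le> \<omega>\<close>])
  have "(LINT x:{a..a + \<omega>}|lborel. G (a + \<omega> - x) - G (a - x)) =
      (- J (a + \<omega> - (a + \<omega>)) + J (a - (a + \<omega>))) - (- J (a + \<omega> - a) + J (a - a))"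
    using assms
    by (intro set_integral_FTC)
       (auto intro!: continuous_intros continuous_on_compose2[OF contG] derivative_eq_intros dJ)
  then show ?thesis
    using J(2) by (simp add: inner)
qed

text \<open>On \<open>[0, pi]\<close> the kernel is \<open>f x * sin x\<close>, so \<open>J\<close> and \<open>H\<close> solve the same initial value problem.\<close>

lemma kernel_potential_on_positive_half:
  fixes f g H H' H'' J :: "real \<Rightarrow> real"
  assumes f: "continuous_on UNIV f" and g: "g = (\<lambda>x. f x * \<bar>sin x\<bar>)"
    and G: "\<And>x. (G has_real_derivative g x) (at x)" "G 0 = 0"
    and J: "\<And>x. (J has_real_derivative G x) (at x)" "J 0 = 0"
    and H: "C2_on {0..pi} H H' H''" "\<And>x. x \<in> {0..pi} \<Longrightarrow> H'' x = f x * sin x" "H 0 = 0" "H' 0 = 0"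
    and x: "x \<in> {0..pi}"
  shows "J x = H x"
proof -
  have Jc: "C2_on {0..pi} J G g"
    unfolding C2_on_def
  proof (intro conjI ballI)
    fix y :: real
    show "(J has_vector_derivative G y) (at y within {0..pi})"
      using J(1)[of y] by (rule DERIV_imp_vector_within)
    show "(G has_vector_derivative g y) (at y within {0..pi})"
      using G(1)[of y] by (rule DERIV_imp_vector_within)
  next
    show "continuous_on {0..pi} g"
      unfolding g by (intro continuous_intros continuous_on_subset[OF f]) auto
  qed
  have "g y = H'' y" if "y \<in> {0..pi}" for y
    using that by (simp add: g H(2) sin_ge_zero)
  from C2_on_unique[OF Jc H(1) this _ _ x] show ?thesis
    using J(2) G(2) H(3,4) by simp
qed

text \<open>On \<open>[- pi, 0]\<close> the kernel is \<open>- f x * sin x\<close>. After reflection, \<open>J\<close> and \<open>- H\<close> solve the same initial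
value problem on \<open>[0, pi]\<close>.\<close>

lemma kernel_potential_on_negative_half:
  fixes f g H H' H'' J :: "real \<Rightarrow> real"
  assumes f: "continuous_on UNIV f" and g: "g = (\<lambda>x. f x * \<bar>sin x\<bar>)"
    and G: "\<And>x. (G has_real_derivative g x) (at x)" "G 0 = 0"
    and J: "\<And>x. (J has_real_derivative G x) (at x)" "J 0 = 0"
    and H: "C2_on {-pi..0} H H' H''" "\<And>x. x \<in> {-pi..0} \<Longrightarrow> H'' x = f x * sin x" "H 0 = 0" "H' 0 = 0"
    and x: "x \<in> {0..pi}"
  shows "J (- x) = - H (- x)"
proof -
  have im: "uminus ` {0..pi} = {-pi..0}" by simp
  have Jr: "C2_on {0..pi} (\<lambda>x. J (- x)) (\<lambda>x. - G (- x)) (\<lambda>x. g (- x))"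
    unfolding C2_on_def
  proof (intro conjI ballI)
    fix y :: real
    have "((\<lambda>x. J (- x)) has_real_derivative - G (- y)) (at y)"
      using DERIV_chain2[OF J(1) DERIV_minus[OF DERIV_ident], of y UNIV] by simp
    then show "((\<lambda>x. J (- x)) has_vector_derivative - G (- y)) (at y within {0..pi})"
      by (rule DERIV_imp_vector_within)
    have "((\<lambda>x. - G (- x)) has_real_derivative g (- y)) (at y)"
      using DERIV_minus[OF DERIV_chain2[OF G(1) DERIV_minus[OF DERIV_ident], of y UNIV]] by simp
    then show "((\<lambda>x. - G (- x)) has_vector_derivative g (- y)) (at y within {0..pi})"
      by (rule DERIV_imp_vector_within)
  next
    show "continuous_on {0..pi} (\<lambda>x. g (- x))"
      unfolding g by (intro continuous_intros continuous_on_compose2[OF f]) auto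
  qed
  have reflect: "((\<lambda>x. F (- x)) has_vector_derivative (- F' (- y))) (at y within {0..pi})"
    if "\<And>z. z \<in> {-pi..0} \<Longrightarrow> (F has_vector_derivative F' z) (at z within {-pi..0})" "y \<in> {0..pi}"
    for F F' :: "real \<Rightarrow> real" and y
  proof -
    have "(uminus has_vector_derivative - 1) (at y within {0..pi})"
      using DERIV_minus[OF DERIV_ident, of y UNIV] by (rule DERIV_imp_vector_within)
    moreover have "(F has_vector_derivative F' (- y)) (at (- y) within uminus ` {0..pi})"
      unfolding im using that(2) by (intro that(1)) simp
    ultimately have "((F \<circ> uminus) has_vector_derivative ((-1) *\<^sub>R F' (- y))) (at y within {0..pi})"
      by (rule vector_diff_chain_within)
    then show ?thesis by (simp add: o_def)
  qed
  have Hr: "C2_on {0..pi} (\<lambda>x. - H (- x)) (\<lambda>x. H' (- x)) (\<lambda>x. - H'' (- x))"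
    unfolding C2_on_def
  proof (intro conjI ballI)
    fix y :: real assume y: "y \<in> {0..pi}"
    have 1: "(H has_vector_derivative H' z) (at z within {-pi..0})"
      and 2: "(H' has_vector_derivative H'' z) (at z within {-pi..0})" if "z \<in> {-pi..0}" for z
      using H(1) that unfolding C2_on_def by blast+
    show "((\<lambda>x. - H (- x)) has_vector_derivative H' (- y)) (at y within {0..pi})"
      using has_vector_derivative_minus[OF reflect[OF 1 y]] by simp
    show "((\<lambda>x. H' (- x)) has_vector_derivative - H'' (- y)) (at y within {0..pi})"
      by (rule reflect[OF 2 y])
  next
    have "continuous_on {-pi..0} H''" using H(1) unfolding C2_on_def by blast
    then have "continuous_on {0..pi} (\<lambda>x. H'' (- x))"
      by (rule continuous_on_compose2) (simp_all add: continuous_on_minus)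
    then show "continuous_on {0..pi} (\<lambda>x. - H'' (- x))"
      by (rule continuous_on_minus)
  qed
  have "g (- y) = - H'' (- y)" if "y \<in> {0..pi}" for y
    using that by (simp add: g H(2) sin_ge_zero)
  from C2_on_unique[OF Jr Hr this _ _ x] show ?thesis
    using J(2) G(2) H(3,4) by simp
qed

lemma even_potential:
  fixes g G J :: "real \<Rightarrow> real"
  assumes even: "\<And>x. g (- x) = g x"
    and G: "\<And>x. (G has_real_derivative g x) (at x)" "G 0 = 0"
    and J: "\<And>x. (J has_real_derivative G x) (at x)" "J 0 = 0"
  shows "J (- x) = J x"
proof -
  have "((\<lambda>x. G x + G (- x)) has_real_derivative 0) (at y)" for y
    using DERIV_add[OF G(1)[of y] DERIV_chain2[OF G(1) DERIV_minus[OF DERIV_ident], of y UNIV]]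
    by (simp add: even)
  then have "G x + G (- x) = G 0 + G (- 0)" for x
    using DERIV_isconst_all[of "\<lambda>x. G x + G (- x)" x 0] by blast
  then have odd: "G (- x) = - G x" for x using G(2) by (simp add: eq_neg_iff_add_eq_0 add.commute)
  have "((\<lambda>x. J x - J (- x)) has_real_derivative 0) (at y)" for y
    using DERIV_diff[OF J(1)[of y] DERIV_chain2[OF J(1) DERIV_minus[OF DERIV_ident], of y UNIV]]
    by (simp add: odd)
  then have "J x - J (- x) = J 0 - J (- 0)"
    using DERIV_isconst_all[of "\<lambda>x. J x - J (- x)" x 0] by blast
  then show ?thesis by simp
qed

section \<open>Integration over the point of intersection\<close>

definition lines_meeting :: "(real^2) set \<Rightarrow> (real \<times> real) set"
  where "lines_meeting K = {(p, \<phi>). 0 < p \<and> 0 \<le> \<phi> \<and> \<phi> < 2 * pi \<and> coord_line p \<phi> \<inter> K \<noteq> {}}"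

lemma line_pairs_meeting_eq: "line_pairs_meeting K = lines_meeting K \<times> lines_meeting K"
  by (auto simp: line_pairs_meeting_def lines_meeting_def)

lemma mem_lines_meeting_through:
  "(P \<bullet> unit_vec \<phi>, \<phi>) \<in> lines_meeting K \<longleftrightarrow>
     \<phi> \<in> {\<phi>\<in>{0..<2 * pi}. 0 < P \<bullet> unit_vec \<phi> \<and> \<phi> \<in> pencil K P}"
  by (auto simp: lines_meeting_def pencil_def coord_line_def)

text \<open>The lines meeting \<open>K\<close> are, up to the conditions \<open>0 < p\<close> and \<open>\<phi> < 2 * pi\<close>, the continuous image of the
compact set of pairs of a point of \<open>K\<close> and a normal angle; this gives measurability, and integrability of
continuous functions.\<close>

lemma lines_meeting_compact_superset:
  assumes "compact K"
  obtains C where "compact C" "lines_meeting K \<subseteq> C" "lines_meeting K \<in> sets borel"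
proof -
  define C where "C = (\<lambda>(x, \<phi>). (x \<bullet> unit_vec \<phi>, \<phi>)) ` (K \<times> {0..2 * pi})"
  have "continuous_on (K \<times> {0..2 * pi}) (\<lambda>(x, \<phi>). (x \<bullet> unit_vec \<phi>, \<phi>))"
    by (auto simp: case_prod_beta intro!: continuous_intros continuous_on_compose2[OF continuous_unit_vec[of UNIV]])
  then have C: "compact C"
    unfolding C_def using assms by (intro compact_continuous_image compact_Times) auto
  have eq: "lines_meeting K = C \<inter> ({0<..} \<times> {..<2 * pi})"
    by (auto simp: lines_meeting_def C_def coord_line_def image_iff)
  have "lines_meeting K \<in> sets borel"
    unfolding eq by (intro sets.Int borel_open borel_compact C open_Times) auto
  then show thesis using that[of C] C eq by blast
qed

lemma borel_pencil:
  assumes "compact K"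
  shows "pencil K P \<in> sets borel"
proof -
  have "closed {z. fst z \<bullet> unit_vec (snd z) = P \<bullet> unit_vec (snd z)}"
    by (intro closed_Collect_eq continuous_intros continuous_on_compose2[OF continuous_unit_vec[of UNIV]]) auto
  from closed_compact_projection[OF assms this] have "closed (pencil K P)"
    by (simp add: pencil_def Bex_def)
  then show ?thesis by (rule borel_closed)
qed

lemma set_integrable_continuous_subset_compact:
  fixes h :: "'a::euclidean_space \<Rightarrow> real"
  assumes "compact C" "continuous_on UNIV h" "A \<subseteq> C" "A \<in> sets borel"
  shows "set_integrable lborel A h"
proof (rule set_integrable_subset[of _ C])
  show "set_integrable lborel C h"
    unfolding set_integrable_def
    by (rule borel_integrable_compact) (use assms in \<open>auto intro: continuous_on_subset\<close>)
qed (use assms in auto)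

lemma integral_line_pairs:
  fixes q :: "(real \<times> real) \<times> (real \<times> real) \<Rightarrow> real"
  assumes q: "integrable lborel q"
  defines "W \<equiv> \<lambda>(P, \<phi>1, \<phi>2). \<bar>sin (\<phi>2 - \<phi>1)\<bar> * q (lines_through (P, \<phi>1, \<phi>2))"
  shows "integrable lborel (\<lambda>P. \<integral>\<phi>. W (P, \<phi>) \<partial>lborel)"
    and "(\<integral>G. q G \<partial>lborel) = (\<integral>P. \<integral>\<phi>. W (P, \<phi>) \<partial>lborel \<partial>lborel)"
proof -
  let ?d = "\<lambda>z :: (real^2) \<times> (real \<times> real). \<bar>sin (snd (snd z) - fst (snd z))\<bar>"
  have [measurable]: "q \<in> borel_measurable borel"
    using borel_measurable_integrable[OF q] by simp
  have [measurable]: "?d \<in> borel_measurable borel"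
    by (intro borel_measurable_continuous_onI continuous_intros)
  have d: "(\<lambda>(P, \<phi>1, \<phi>2). ennreal \<bar>sin (\<phi>2 - \<phi>1)\<bar>) = (\<lambda>z :: (real^2) \<times> (real \<times> real). ennreal (?d z))"
    by (simp add: fun_eq_iff)
  have eq: "lborel = distr (density lborel (\<lambda>z. ennreal (?d z))) borel lines_through"
    by (rule lborel_line_pairs[unfolded d])
  have W: "W = (\<lambda>z. ?d z *\<^sub>R q (lines_through z))"
    by (auto simp: W_def fun_eq_iff)
  have "integrable lborel W"
    using q unfolding W
    by (subst (asm) eq) (simp add: integrable_distr_eq integrable_density)
  then have Wi: "integrable (lborel \<Otimes>\<^sub>M lborel) W" by (simp add: lborel_prod)
  show "integrable lborel (\<lambda>P. \<integral>\<phi>. W (P, \<phi>) \<partial>lborel)"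
    by (rule lborel_pair.integrable_fst'[OF Wi])
  have "(\<integral>G. q G \<partial>lborel) = (\<integral>z. W z \<partial>lborel)"
    unfolding W by (subst eq) (simp add: integral_distr integral_density)
  also have "\<dots> = (\<integral>P. \<integral>\<phi>. W (P, \<phi>) \<partial>lborel \<partial>lborel)"
    using lborel_pair.integral_fst'[OF Wi] by (simp add: lborel_prod)
  finally show "(\<integral>G. q G \<partial>lborel) = (\<integral>P. \<integral>\<phi>. W (P, \<phi>) \<partial>lborel \<partial>lborel)" .
qed

text \<open>After integration over one angle the integrand is still \<open>pi\<close>-periodic in the other, so the two
integrals can be moved to the arc one after the other.\<close>

lemma double_integral_over_pencil:
  fixes g :: "real \<Rightarrow> real"
  assumes comp: "compact K" and P: "P \<noteq> 0"
    and g: "continuous_on UNIV g" and per: "\<And>x. g (x + pi) = g x"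
    and G: "\<And>x. (G has_real_derivative g x) (at x)"
    and J: "\<And>x. (J has_real_derivative G x) (at x)" "J 0 = 0"
    and arc: "pencil K P \<inter> {a..<a + pi} = {a..a + \<omega>} \<inter> {a..<a + pi}" and \<omega>: "0 \<le> \<omega>" "\<omega> \<le> pi"
  defines "A \<equiv> {\<phi>\<in>{0..<2 * pi}. 0 < P \<bullet> unit_vec \<phi> \<and> \<phi> \<in> pencil K P}"
  shows "(\<integral>\<phi>. indicator (A \<times> A) \<phi> * g (snd \<phi> - fst \<phi>) \<partial>lborel) = J \<omega> + J (- \<omega>)"
proof -
  have [measurable]: "pencil K P \<in> sets borel" by (rule borel_pencil[OF comp])
  have A [measurable]: "A \<in> sets borel" unfolding A_def by measurable
  have AA: "A \<times> A \<in> sets borel"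
    using A by (simp add: borel_prod[symmetric])
  have "set_integrable lborel (A \<times> A) (\<lambda>\<phi>. g (snd \<phi> - fst \<phi>))"
  proof (rule set_integrable_continuous_subset_compact[OF _ _ _ AA])
    show "compact ({0..2 * pi} \<times> {0..2 * pi})" by (intro compact_Times) auto
    show "continuous_on UNIV (\<lambda>\<phi>. g (snd \<phi> - fst \<phi>))"
      by (intro continuous_on_compose2[OF g] continuous_intros) auto
  qed (auto simp: A_def)
  then have "integrable (lborel \<Otimes>\<^sub>M lborel) (\<lambda>\<phi>. indicator (A \<times> A) \<phi> * g (snd \<phi> - fst \<phi>))"
    by (simp add: set_integrable_def lborel_prod)
  from lborel_pair.integral_fst'[OF this]
  have "(\<integral>\<phi>. indicator (A \<times> A) \<phi> * g (snd \<phi> - fst \<phi>) \<partial>lborel) =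
     (\<integral>x. \<integral>y. indicator (A \<times> A) (x, y) * g (y - x) \<partial>lborel \<partial>lborel)"
    by (simp add: lborel_prod)
  also have "\<dots> = (LINT x:A|lborel. LINT y:A|lborel. g (y - x))"
    unfolding set_lebesgue_integral_def
    by (intro Bochner_Integration.integral_cong refl) (simp add: indicator_times mult.assoc)
  also have "\<dots> = (LINT x:A|lborel. LINT y:{a..a + \<omega>}|lborel. g (y - x))"
  proof -
    have "(LINT y:A|lborel. g (y - x)) = (LINT y:{a..a + \<omega>}|lborel. g (y - x))" for x
      unfolding A_def
    proof (rule integral_normals_of_pencil[OF P _ _ _ pencil_periodic arc \<omega>])
      show "g (y + pi - x) = g (y - x)" for y using per[of "y - x"] by (simp add: algebra_simps)
      show "set_integrable lborel {b..<c} (\<lambda>y. g (y - x))" for b c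
        by (rule set_integrable_continuous_subset_compact[of "{b..c}"])
           (auto intro!: continuous_on_compose2[OF g] continuous_intros)
    qed simp
    then show ?thesis by simp
  qed
  also have "\<dots> = (LINT x:{a..a + \<omega>}|lborel. LINT y:{a..a + \<omega>}|lborel. g (y - x))"
    unfolding A_def
  proof (rule integral_normals_of_pencil[OF P _ _ _ pencil_periodic arc \<omega>])
    show "(LINT y:{a..a + \<omega>}|lborel. g (y - (x + pi))) = (LINT y:{a..a + \<omega>}|lborel. g (y - x))" for x
    proof -
      have "g (y - (x + pi)) = g (y - x)" for y using per[of "y - (x + pi)"] by simp
      then show ?thesis by simp
    qed
    have contG: "continuous_on UNIV G"
      using G by (meson DERIV_isCont continuous_at_imp_continuous_on)
    have "(LINT y:{a..a + \<omega>}|lborel. g (y - x)) = G (a + \<omega> - x) - G (a - x)" for x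
      by (rule integral_difference_kernel[OF g G \<omega>(1)])
    then show "set_integrable lborel {b..<c} (\<lambda>x. LINT y:{a..a + \<omega>}|lborel. g (y - x))" for b c
      by (intro set_integrable_continuous_subset_compact[of "{b..c}"])
         (auto intro!: continuous_on_compose2[OF contG] continuous_intros)
  qed simp
  also have "\<dots> = J \<omega> + J (- \<omega>)"
    by (rule double_integral_difference_kernel[OF g G J \<omega>(1)])
  finally show ?thesis .
qed

text \<open>The theorem in terms of a second antiderivative \<open>J\<close> of the kernel on the whole line, which serves
every choice of \<open>H\<close> at once.\<close>

lemma line_pairs_integral_potential:
  fixes K :: "(real^2) set" and f :: "real \<Rightarrow> real"
  assumes comp: "compact K" and conv: "convex K" and int: "0 \<in> interior K" and bd: "C2_boundary K"
    and f: "continuous_on UNIV f" and per: "\<And>x. f (x + pi) = f x"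
    and g: "g = (\<lambda>x. f x * \<bar>sin x\<bar>)"
    and G: "\<And>x. (G has_real_derivative g x) (at x)"
    and J: "\<And>x. (J has_real_derivative G x) (at x)" "J 0 = 0"
  shows "set_integrable lborel (line_pairs_meeting K) (\<lambda>((p1, \<phi>1), (p2, \<phi>2)). f (\<phi>2 - \<phi>1))" (is ?A)
    and "set_integrable lborel (- K) (\<lambda>P. J (visual_angle K P) + J (- visual_angle K P))" (is ?B)
    and "(LINT G:line_pairs_meeting K|lborel. (\<lambda>((p1, \<phi>1), (p2, \<phi>2)). f (\<phi>2 - \<phi>1)) G) =
       (J pi + J (- pi)) * measure lborel K +
       (LINT P:- K|lborel. J (visual_angle K P) + J (- visual_angle K P))" (is ?C)
proof -
  let ?f = "\<lambda>((p1, \<phi>1), (p2, \<phi>2)). f (\<phi>2 - \<phi>1) :: real"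
  let ?M = "line_pairs_meeting K"
  obtain C where C: "compact C" "lines_meeting K \<subseteq> C" "lines_meeting K \<in> sets borel"
    by (rule lines_meeting_compact_superset[OF comp])
  show A: ?A
  proof (rule set_integrable_continuous_subset_compact[of "C \<times> C"])
    show "compact (C \<times> C)" using C by (intro compact_Times)
    show "?M \<subseteq> C \<times> C" using C by (auto simp: line_pairs_meeting_eq)
    have "lines_meeting K \<times> lines_meeting K \<in> sets (borel \<Otimes>\<^sub>M borel)"
      using C(3) by (intro pair_measureI)
    then show "?M \<in> sets borel" by (simp only: line_pairs_meeting_eq borel_prod)
    show "continuous_on UNIV ?f"
      unfolding case_prod_beta by (intro continuous_on_compose2[OF f] continuous_intros) auto
  qed
  define q where "q G = indicator ?M G *\<^sub>R ?f G" for G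
  have q: "integrable lborel q"
    using A by (simp add: q_def[abs_def] set_integrable_def)
  \<comment> \<open>The inner integral over the pairs of lines that intersect at \<open>P\<close>.\<close>
  define I where "I P = (\<integral>\<phi>. (\<lambda>(P, \<phi>1, \<phi>2). \<bar>sin (\<phi>2 - \<phi>1)\<bar> * q (lines_through (P, \<phi>1, \<phi>2))) (P, \<phi>) \<partial>lborel)" for P
  have I: "integrable lborel I" "(\<integral>G. q G \<partial>lborel) = (\<integral>P. I P \<partial>lborel)"
    unfolding I_def[abs_def] by (rule integral_line_pairs[OF q])+
  have contg: "continuous_on UNIV g"
    unfolding g by (intro continuous_intros f)
  have perg: "g (x + pi) = g x" for x by (simp add: g per)
  have I_arc: "I P = J \<omega> + J (- \<omega>)"
    if "P \<noteq> 0" "pencil K P \<inter> {a..<a + pi} = {a..a + \<omega>} \<inter> {a..<a + pi}" "0 \<le> \<omega>" "\<omega> \<le> pi" for P a \<omega>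
  proof -
    let ?A = "{\<phi>\<in>{0..<2 * pi}. 0 < P \<bullet> unit_vec \<phi> \<and> \<phi> \<in> pencil K P}"
    have "I P = (\<integral>\<phi>. indicator (?A \<times> ?A) \<phi> * g (snd \<phi> - fst \<phi>) \<partial>lborel)"
      unfolding I_def
    proof (intro Bochner_Integration.integral_cong refl)
      fix \<phi> :: "real \<times> real"
      have "indicator ?M (lines_through (P, \<phi>)) = (indicator (?A \<times> ?A) \<phi> :: real)"
        by (cases \<phi>) (simp add: lines_through_def line_pairs_meeting_eq indicator_def mem_lines_meeting_through del: mem_Collect_eq)
      then show "(case (P, \<phi>) of (P, \<phi>1, \<phi>2) \<Rightarrow> \<bar>sin (\<phi>2 - \<phi>1)\<bar> * q (lines_through (P, \<phi>1, \<phi>2))) =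
          indicator (?A \<times> ?A) \<phi> * g (snd \<phi> - fst \<phi>)"
        by (cases \<phi>) (simp add: q_def g lines_through_def)
    qed
    also have "\<dots> = J \<omega> + J (- \<omega>)"
      by (rule double_integral_over_pencil[OF comp that(1) contg perg G J that(2-4)])
    finally show ?thesis .
  qed
  have in_K: "I P = J pi + J (- pi)" if "P \<in> K" "P \<noteq> 0" for P
    by (rule I_arc[OF that(2), of 0]) (auto simp: pencil_of_mem[OF that(1)])
  \<comment> \<open>Outside \<open>K\<close> the identity holds at every point, not only almost everywhere; it is the source of the
      measurability of the visual angle terms.\<close>
  have out_K: "I P = J (visual_angle K P) + J (- visual_angle K P)" if "P \<in> - K" for P
  proof -
    have ne: "interior K \<noteq> {}" and "P \<notin> K" using int that by auto
    have "P \<noteq> 0" using int interior_subset that by fastforce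
    obtain a where a: "0 < visual_angle K P" "visual_angle K P < pi"
      "pencil K P \<inter> {a..<a + pi} = {a..a + visual_angle K P}"
      by (rule pencil_visual_angle[OF comp conv ne bd \<open>P \<notin> K\<close>])
    show ?thesis
      by (rule I_arc[OF \<open>P \<noteq> 0\<close>, of a]) (use a in auto)
  qed
  have K [measurable]: "K \<in> sets borel" using comp by (simp add: borel_compact)
  have Iset: "set_integrable lborel S I" if "S \<in> sets borel" for S
    using integrable_mult_indicator[OF _ I(1), of S] that by (simp add: set_integrable_def)
  show B: ?B
    using Iset[of "- K"] K by (subst set_integrable_cong[OF refl refl out_K[symmetric]]) auto
  have "(LINT G:?M|lborel. ?f G) = (\<integral>P. I P \<partial>lborel)"
    using I(2) by (simp add: q_def set_lebesgue_integral_def)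
  also have "\<dots> = (LINT P:K \<union> - K|lborel. I P)"
    by (simp add: set_lebesgue_integral_def)
  also have "\<dots> = (LINT P:K|lborel. I P) + (LINT P:- K|lborel. I P)"
    by (rule set_integral_Un) (auto intro!: Iset)
  \<comment> \<open>At the origin no line has a positive distance, but a single point is negligible.\<close>
  also have "(LINT P:K|lborel. I P) = (LINT P:K|lborel. J pi + J (- pi))"
    unfolding set_lebesgue_integral_def
  proof (rule integral_cong_AE)
    have [measurable]: "I \<in> borel_measurable borel" using borel_measurable_integrable[OF I(1)] by simp
    show "(\<lambda>x. indicator K x *\<^sub>R I x) \<in> borel_measurable lborel" by simp
    show "(\<lambda>x. indicator K x *\<^sub>R (J pi + J (- pi))) \<in> borel_measurable lborel" by simp
    show "AE x in lborel. indicator K x *\<^sub>R I x = indicator K x *\<^sub>R (J pi + J (- pi))"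
      using AE_lborel_singleton[of 0] by eventually_elim (auto simp: indicator_def in_K)
  qed
  also have "\<dots> = (J pi + J (- pi)) * measure lborel K"
    using emeasure_compact_finite[OF comp] by (subst set_integral_const) auto
  also have "(LINT P:- K|lborel. I P) = (LINT P:- K|lborel. J (visual_angle K P) + J (- visual_angle K P))"
    by (rule set_lebesgue_integral_cong) (use out_K in auto)
  finally show ?C .
qed

theorem corollary2:
  fixes K :: "(real^2) set" and f :: "real \<Rightarrow> real"
  assumes "compact K" and "convex K" and "0 \<in> interior K" and "C2_boundary K"
    and "continuous_on UNIV f" and "\<And>x. f (x + pi) = f x"
  shows "set_integrable lborel (line_pairs_meeting K) (\<lambda>((p1, \<phi>1), (p2, \<phi>2)). f (\<phi>2 - \<phi>1))
    \<and> (\<forall>H H' H''.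
        C2_on {-pi..pi} H H' H'' \<and> (\<forall>x\<in>{-pi..pi}. H'' x = f x * sin x) \<and> H 0 = 0 \<and> H' 0 = 0 \<longrightarrow>
        set_integrable lborel (- K) (\<lambda>P. H (visual_angle K P) - H (- visual_angle K P)) \<and>
        set_lebesgue_integral lborel (line_pairs_meeting K)
            (\<lambda>((p1, \<phi>1), (p2, \<phi>2)). f (\<phi>2 - \<phi>1))
          = (H pi - H (- pi)) * measure lborel K
            + set_lebesgue_integral lborel (- K)
                (\<lambda>P. H (visual_angle K P) - H (- visual_angle K P)))
    \<and> ((\<forall>x. f (- x) = f x) \<longrightarrow>
       (\<forall>H H' H''.
        C2_on {0..pi} H H' H'' \<and> (\<forall>x\<in>{0..pi}. H'' x = f x * sin x) \<and> H 0 = 0 \<and> H' 0 = 0 \<longrightarrow>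
        set_integrable lborel (- K) (\<lambda>P. H (visual_angle K P)) \<and>
        set_lebesgue_integral lborel (line_pairs_meeting K)
            (\<lambda>((p1, \<phi>1), (p2, \<phi>2)). f (\<phi>2 - \<phi>1))
          = 2 * H pi * measure lborel K
            + 2 * set_lebesgue_integral lborel (- K) (\<lambda>P. H (visual_angle K P))))"
proof -
  define g where g: "g = (\<lambda>x. f x * \<bar>sin x\<bar>)"
  have "continuous_on UNIV g" unfolding g by (intro continuous_intros assms(5))
  from continuous_antiderivative_at_zero[OF this]
  obtain G where G: "G 0 = 0" "\<And>x. (G has_real_derivative g x) (at x)" by metis
  from G(2) have "continuous_on UNIV G"
    by (meson DERIV_isCont continuous_at_imp_continuous_on)
  from continuous_antiderivative_at_zero[OF this]
  obtain J where J: "J 0 = 0" "\<And>x. (J has_real_derivative G x) (at x)" by metis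
  note main = line_pairs_integral_potential[OF assms g G(2) J(2,1)]
  let ?v = "visual_angle K"
  have v: "?v P \<in> {0..pi}" if "P \<in> - K" for P
  proof -
    have "interior K \<noteq> {}" "P \<notin> K" using assms(3) that by auto
    then obtain a where "0 < ?v P" "?v P < pi"
      by (rule pencil_visual_angle[OF assms(1,2) _ assms(4)])
    then show ?thesis by simp
  qed
  have transfer: "set_integrable lborel (- K) (\<lambda>P. \<Phi> (?v P)) \<and>
      set_lebesgue_integral lborel (line_pairs_meeting K) (\<lambda>((p1, \<phi>1), (p2, \<phi>2)). f (\<phi>2 - \<phi>1))
        = \<Phi> pi * measure lborel K + (LINT P:- K|lborel. \<Phi> (?v P))"
    if \<Phi>: "\<And>x. x \<in> {0..pi} \<Longrightarrow> \<Phi> x = J x + J (- x)" for \<Phi>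
  proof -
    have "set_integrable lborel (- K) (\<lambda>P. \<Phi> (?v P)) =
        set_integrable lborel (- K) (\<lambda>P. J (?v P) + J (- ?v P))"
      by (rule set_integrable_cong) (use \<Phi> v in auto)
    moreover have "(LINT P:- K|lborel. \<Phi> (?v P)) = (LINT P:- K|lborel. J (?v P) + J (- ?v P))"
      by (rule set_lebesgue_integral_cong) (use \<Phi> v assms(1) in \<open>auto intro: borel_comp borel_compact\<close>)
    ultimately show ?thesis using main(2,3) \<Phi>[of pi] by simp
  qed
  show ?thesis
  proof (intro conjI allI impI; (elim conjE)?)
    show "set_integrable lborel (line_pairs_meeting K) (\<lambda>((p1, \<phi>1), (p2, \<phi>2)). f (\<phi>2 - \<phi>1))"
      by (rule main(1))
  next
    fix H H' H''
    assume H: "C2_on {-pi..pi} H H' H''" "\<forall>x\<in>{-pi..pi}. H'' x = f x * sin x" "H 0 = 0" "H' 0 = 0"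
    have sub: "C2_on {0..pi} H H' H''" "C2_on {-pi..0} H H' H''"
      by (rule C2_on_subset[OF H(1)], simp)+
    have "H x - H (- x) = J x + J (- x)" if "x \<in> {0..pi}" for x
      using kernel_potential_on_positive_half[OF assms(5) g G(2,1) J(2,1) sub(1) _ H(3,4) that]
        kernel_potential_on_negative_half[OF assms(5) g G(2,1) J(2,1) sub(2) _ H(3,4) that] H(2) by simp
    from transfer[of "\<lambda>x. H x - H (- x)", OF this]
    show "set_integrable lborel (- K) (\<lambda>P. H (?v P) - H (- ?v P))"
      and "set_lebesgue_integral lborel (line_pairs_meeting K) (\<lambda>((p1, \<phi>1), (p2, \<phi>2)). f (\<phi>2 - \<phi>1))
          = (H pi - H (- pi)) * measure lborel K + (LINT P:- K|lborel. H (?v P) - H (- ?v P))"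
      by simp_all
  next
    fix H H' H''
    assume even: "\<forall>x. f (- x) = f x"
      and H: "C2_on {0..pi} H H' H''" "\<forall>x\<in>{0..pi}. H'' x = f x * sin x" "H 0 = 0" "H' 0 = 0"
    have H2: "J x = H x" if "x \<in> {0..pi}" for x
      by (rule kernel_potential_on_positive_half[OF assms(5) g G(2,1) J(2,1) H(1) _ H(3,4) that]) (use H(2) in auto)
    have "J (- x) = J x" for x
      by (rule even_potential[OF _ G(2,1) J(2,1)]) (simp add: g even)
    with H2 have "2 * H x = J x + J (- x)" if "x \<in> {0..pi}" for x using that by simp
    from transfer[of "\<lambda>x. 2 * H x", OF this]
    show "set_integrable lborel (- K) (\<lambda>P. H (?v P))"
      and "set_lebesgue_integral lborel (line_pairs_meeting K) (\<lambda>((p1, \<phi>1), (p2, \<phi>2)). f (\<phi>2 - \<phi>1))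
          = 2 * H pi * measure lborel K + 2 * (LINT P:- K|lborel. H (?v P))"
      by simp_all
  qed
qed

end
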